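(* Let $b\neq0$ and assume $\lambda_1>0$, $\lambda_2\le0$, $\lambda_3>0$. Let either $0<p<\frac43$ and $c>0$ be arbitrary, or $p=\frac43$ and $0<c<\lambda_3^{-\frac32}\|R\|_{L^2}^2$, where $R$ is the unique ground state of $-\Delta w+w-|w|^{4/3}w=0$ in $\mathbb{R}^3$. Then $\mathcal{M}_c=\emptyset$, namely $m(c):=\inf_{u\in\bar S(c)}E_b(u)$ has no minimizers.
   Context: $X:=\{u\in H^1(\mathbb{R}^3):\int_{\mathbb{R}^3}(x_1^2+x_2^2)|u|^2dx<\infty\}$ (complex-valued), $\bar S(c):=\{u\in X:\|u\|_{L^2}^2=c\}$, $$E_b(u):=\frac12\|\nabla u\|_{L^2}^2+\frac{b^2}{2}\int_{\mathbb{R}^3}(x_1^2+x_2^2)|u|^2dx+\frac{\lambda_1}{2}\int_{\mathbb{R}^3}\frac{|u|^2}{|x|}dx+\frac{\lambda_2}{4}\int_{\mathbb{R}^3}(|x|^{-1}\ast|u|^2)|u|^2dx-\frac{\lambda_3}{p+2}\|u\|_{L^{p+2}}^{p+2},$$ and $\mathcal{M}_c:=\{u\in\bar S(c):E_b(u)=m(c)\}$. The ground state $R$ is the unique positive radial $H^1(\mathbb{R}^3)$ solution (up to translation and phase) of its equation. *)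

theory Defs
  imports "HOL-Analysis.Analysis"
begin

type_synonym R3 = "real ^ 3"

section \<open>Test functions\<close>

definition partial_deriv :: "'n \<Rightarrow> (real ^ 'n::finite \<Rightarrow> real) \<Rightarrow> real ^ 'n \<Rightarrow> real" where
  "partial_deriv i f x = frechet_derivative f (at x) (axis i 1)"

primrec Ck :: "nat \<Rightarrow> (real ^ 'n::finite \<Rightarrow> real) \<Rightarrow> bool" where
  "Ck 0 f \<longleftrightarrow> continuous_on UNIV f"
| "Ck (Suc k) f \<longleftrightarrow> (\<forall>x. f differentiable (at x)) \<and> (\<forall>i. Ck k (partial_deriv i f))"

definition test_functions :: "(real ^ 'n::finite \<Rightarrow> real) set" where
  "test_functions = {\<phi>. (\<forall>k. Ck k \<phi>) \<and> compact (closure {x. \<phi> x \<noteq> 0})}"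

section \<open>Lebesgue and Sobolev spaces\<close>

text \<open>
  Elements of function spaces are represented by Borel measurable functions; functions that agree
  almost everywhere are not identified. Every almost-everywhere class of Lebesgue
  measurable functions has a Borel representative, and all quantities below depend only on the class.
\<close>

definition Lp_space :: "real \<Rightarrow> (R3 \<Rightarrow> 'b::euclidean_space) set" where
  "Lp_space q = {f. f \<in> borel_measurable lborel \<and> integrable lborel (\<lambda>x. norm (f x) powr q)}"

definition Lp_norm :: "real \<Rightarrow> (R3 \<Rightarrow> 'b::euclidean_space) \<Rightarrow> real" where
  "Lp_norm q f = (\<integral>x. norm (f x) powr q \<partial>lborel) powr (1 / q)"

definition locally_integrable :: "(R3 \<Rightarrow> 'b::euclidean_space) \<Rightarrow> bool" where
  "locally_integrable f \<longleftrightarrow>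
     f \<in> borel_measurable lborel \<and> (\<forall>K. compact K \<longrightarrow> set_integrable lborel K f)"

text \<open>
  Real-valued test functions suffice for complex-valued \<open>u\<close>, by linearity. The norm of
  \<^typ>\<open>complex ^ 3\<close> is the Hermitian one, so \<open>norm (g x)\<close> is the usual length of a complex gradient.
\<close>

definition is_weak_gradient :: "(R3 \<Rightarrow> complex) \<Rightarrow> (R3 \<Rightarrow> complex ^ 3) \<Rightarrow> bool" where
  "is_weak_gradient u g \<longleftrightarrow> locally_integrable u \<and> locally_integrable g \<and>
     (\<forall>\<phi>\<in>test_functions. \<forall>i.
        (\<integral>x. partial_deriv i \<phi> x *\<^sub>R u x \<partial>lborel) = - (\<integral>x. \<phi> x *\<^sub>R (g x $ i) \<partial>lborel))"

text \<open>A weak gradient is unique up to null sets, so the choice below is immaterial.\<close>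

definition weak_gradient :: "(R3 \<Rightarrow> complex) \<Rightarrow> R3 \<Rightarrow> complex ^ 3" where
  "weak_gradient u = (SOME g. is_weak_gradient u g)"

definition H1 :: "(R3 \<Rightarrow> complex) set" where
  "H1 = {u. u \<in> Lp_space 2 \<and> (\<exists>g. is_weak_gradient u g \<and> g \<in> Lp_space 2)}"

section \<open>The energy and its constrained minimizers\<close>

definition X_space :: "(R3 \<Rightarrow> complex) set" where
  "X_space = {u \<in> H1. integrable lborel (\<lambda>x. ((x $ 1)\<^sup>2 + (x $ 2)\<^sup>2) * (norm (u x))\<^sup>2)}"

definition mass_sphere :: "real \<Rightarrow> (R3 \<Rightarrow> complex) set" where
  "mass_sphere c = {u \<in> X_space. (Lp_norm 2 u)\<^sup>2 = c}"

definition convolution :: "(R3 \<Rightarrow> real) \<Rightarrow> (R3 \<Rightarrow> real) \<Rightarrow> R3 \<Rightarrow> real" where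
  "convolution f g x = (\<integral>y. f (x - y) * g y \<partial>lborel)"

text \<open>
  For \<open>0 < p \<le> 4\<close> all integrals in the energy converge for \<open>u\<close> in \<^const>\<open>X_space\<close> (Hardy,
  Hardy-Littlewood-Sobolev and Sobolev inequalities), so the value 0 that the Bochner integral
  assigns to divergent integrals plays no role.
\<close>

definition energy ::
    "real \<Rightarrow> real \<Rightarrow> real \<Rightarrow> real \<Rightarrow> real \<Rightarrow> (R3 \<Rightarrow> complex) \<Rightarrow> real" where
  "energy b lam1 lam2 lam3 p u =
     1 / 2 * (Lp_norm 2 (weak_gradient u))\<^sup>2
     + b\<^sup>2 / 2 * (\<integral>x. ((x $ 1)\<^sup>2 + (x $ 2)\<^sup>2) * (norm (u x))\<^sup>2 \<partial>lborel)
     + lam1 / 2 * (\<integral>x. (norm (u x))\<^sup>2 / norm x \<partial>lborel)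
     + lam2 / 4 * (\<integral>x. convolution (\<lambda>y. 1 / norm y) (\<lambda>y. (norm (u y))\<^sup>2) x * (norm (u x))\<^sup>2 \<partial>lborel)
     - lam3 / (p + 2) * Lp_norm (p + 2) u powr (p + 2)"

text \<open>
  The infimum is taken in the extended reals, since the infimum of a set of reals that is unbounded
  below is an unspecified real number.
\<close>

definition min_energy :: "real \<Rightarrow> real \<Rightarrow> real \<Rightarrow> real \<Rightarrow> real \<Rightarrow> real \<Rightarrow> ereal" where
  "min_energy b lam1 lam2 lam3 p c = (INF u\<in>mass_sphere c. ereal (energy b lam1 lam2 lam3 p u))"

definition minimizers ::
    "real \<Rightarrow> real \<Rightarrow> real \<Rightarrow> real \<Rightarrow> real \<Rightarrow> real \<Rightarrow> (R3 \<Rightarrow> complex) set" where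
  "minimizers b lam1 lam2 lam3 p c =
     {u \<in> mass_sphere c. ereal (energy b lam1 lam2 lam3 p u) = min_energy b lam1 lam2 lam3 p c}"

section \<open>The ground state\<close>

text \<open>Positive radial weak solutions \<open>w\<close> in \<^const>\<open>H1\<close> of \<open>- \<Delta>w + w - |w|^(4/3) w = 0\<close>.\<close>

definition is_ground_state :: "(R3 \<Rightarrow> real) \<Rightarrow> bool" where
  "is_ground_state w \<longleftrightarrow>
     (\<lambda>x. complex_of_real (w x)) \<in> H1 \<and>
     (\<forall>x. 0 < w x) \<and>
     (\<forall>x y. norm x = norm y \<longrightarrow> w x = w y) \<and>
     (\<forall>\<phi>\<in>test_functions.
        (\<integral>x. (\<Sum>i\<in>UNIV. partial_deriv i \<phi> x *\<^sub>R (weak_gradient (\<lambda>x. complex_of_real (w x)) x $ i))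
             + complex_of_real (\<phi> x * (w x - \<bar>w x\<bar> powr (4 / 3) * w x)) \<partial>lborel) = 0)"

end

theory Submission
  imports Defs
begin

text \<open>
  The trap and all terms of the energy except the Coulomb potential \<open>\<bar>x\<bar>\<^bsup>-1\<^esup>\<close> are invariant under
  translations along the \<open>x\<^sub>3\<close> axis, while the Coulomb term, which is positive for a nonzero state
  because \<open>lam1 > 0\<close>, tends to zero when the state is moved to infinity along that axis. Hence
  every candidate minimizer has a translate of the same mass and strictly smaller energy.

  Two analytic facts are needed. Invariance of the gradient term rests on the uniqueness of weak
  gradients. Finiteness and decay of the Coulomb term follow from Hardy's inequality
  \<open>\<parallel>u / \<bar>x\<bar>\<parallel> \<le> C \<parallel>\<nabla>u\<parallel>\<close>, since \<open>1 / \<bar>x\<bar> \<le> d / \<bar>x\<bar>\<^sup>2 + 1 / max d \<bar>x\<bar>\<close>. Hardy's inequality is obtained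
  for weak gradients without mollification, by integrating difference quotients of \<open>u\<close> against
  the field \<open>x / (\<bar>x\<bar>\<^sup>2 + e\<^sup>2)\<close>.
\<close>

text \<open>The obstacle is the singularity of the Coulomb kernel: pushing an L^2 state to infinity
  does not by itself make its integral against 1/|x| small, because the tail passing over the origin
  may still be concentrated there. Hardy's inequality bounds the contribution near the origin by d
  times a gradient norm that is the same for all translates, and what remains is a bounded kernel.
  Finiteness matters for a second reason: a divergent Bochner integral has the value 0, so for such
  a state the Coulomb term could not drop strictly. In Hardy's inequality the weighted integral of
  |u|^2 reappears on the right and has to be absorbed on the left, which is legitimate only if it is
  known to be finite. Hence the parameter e, removed at the end by Fatou's lemma. Difference
  quotients replace the product and chain rules for |u|^2, which for a weak gradient would call for
  an approximation argument; only the reverse triangle inequality is used.\<close>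

section \<open>Translation invariance of the Lebesgue integral\<close>

lemma integrable_lborel_translate_iff:
  fixes f :: "'a::euclidean_space \<Rightarrow> 'b::{banach, second_countable_topology}"
  shows "integrable lborel (\<lambda>x. f (x + a)) \<longleftrightarrow> integrable lborel f"
proof -
  have *: "integrable lborel (\<lambda>x. g (x + c))" if "integrable lborel g" for g :: "'a \<Rightarrow> 'b" and c
  proof -
    have "integrable (distr lborel borel ((+) c)) g"
      using that by (simp add: lborel_distr_plus)
    then have "integrable lborel (\<lambda>x. g (c + x))"
      using borel_measurable_integrable[OF that] by (subst (asm) integrable_distr_eq) simp_all
    then show ?thesis by (simp add: add.commute)
  qed
  show ?thesis
    using *[of f a] *[of "\<lambda>x. f (x + a)" "- a"] by auto
qed

text \<open>Integrability is preserved in both directions, so when one side diverges both Bochner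
  integrals are 0. Terms of the energy can therefore be shifted without a proof of
  convergence.\<close>

lemma integral_lborel_translate:
  fixes f :: "'a::euclidean_space \<Rightarrow> 'b::{banach, second_countable_topology}"
  shows "(\<integral>x. f (x + a) \<partial>lborel) = (\<integral>x. f x \<partial>lborel)"
proof (cases "integrable lborel f")
  case True
  have "(\<integral>x. f x \<partial>lborel) = (\<integral>x. f x \<partial>distr lborel borel ((+) a))"
    by (simp add: lborel_distr_plus)
  also have "\<dots> = (\<integral>x. f (a + x) \<partial>lborel)"
    using borel_measurable_integrable[OF True] by (subst integral_distr) simp_all
  finally show ?thesis by (simp add: add.commute)
next
  case False
  then show ?thesis
    using integrable_lborel_translate_iff[of f a] by (simp add: not_integrable_integral_eq)
qed

section \<open>Test functions\<close>

lemma partial_deriv_eq: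
  "(f has_derivative f') (at x) \<Longrightarrow> partial_deriv i f x = f' (axis i 1)"
  by (simp add: partial_deriv_def flip: frechet_derivative_at)

text \<open>\<open>Ck (Suc k)\<close> constrains only the partial derivatives; at the bottom,
  differentiability supplies continuity. The product rule needs this, since undifferentiated factors
  stand next to differentiated ones.\<close>

lemma Ck_Suc_imp_Ck: "Ck (Suc k) f \<Longrightarrow> Ck k f"
proof (induction k arbitrary: f)
  case 0
  then show ?case
    by (auto intro!: continuous_at_imp_continuous_on differentiable_imp_continuous_within)
next
  case (Suc k)
  then show ?case by (metis Ck.simps(2))
qed

lemma Ck_imp_continuous_on: "Ck k f \<Longrightarrow> continuous_on UNIV f"
  by (induction k) (use Ck_Suc_imp_Ck in auto)

lemma Ck_const: "Ck k (\<lambda>x. c)"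
proof (induction k arbitrary: c)
  case (Suc k)
  have "partial_deriv i (\<lambda>x::real^'a. c) = (\<lambda>x. 0)" for i
    by (rule ext) (rule partial_deriv_eq[OF has_derivative_const])
  with Suc show ?case by simp
qed simp

lemma Ck_add: "Ck k f \<Longrightarrow> Ck k g \<Longrightarrow> Ck k (\<lambda>x. f x + g x)"
proof (induction k arbitrary: f g)
  case 0
  then show ?case by (auto intro: continuous_intros)
next
  case (Suc k)
  have "partial_deriv i (\<lambda>x. f x + g x) = (\<lambda>x. partial_deriv i f x + partial_deriv i g x)" for i
  proof
    fix x
    have "(f has_derivative frechet_derivative f (at x)) (at x)"
      "(g has_derivative frechet_derivative g (at x)) (at x)"
      using Suc.prems by (simp_all add: frechet_derivative_works)
    from partial_deriv_eq[OF has_derivative_add[OF this]]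
    show "partial_deriv i (\<lambda>x. f x + g x) x = partial_deriv i f x + partial_deriv i g x"
      by (simp add: partial_deriv_def)
  qed
  with Suc show ?case by (auto intro: differentiable_add)
qed

lemma Ck_mult: "Ck k f \<Longrightarrow> Ck k g \<Longrightarrow> Ck k (\<lambda>x. f x * g x)"
proof (induction k arbitrary: f g)
  case 0
  then show ?case by (auto intro: continuous_intros)
next
  case (Suc k)
  have "partial_deriv i (\<lambda>x. f x * g x) = (\<lambda>x. f x * partial_deriv i g x + partial_deriv i f x * g x)" for i
  proof
    fix x
    have "(f has_derivative frechet_derivative f (at x)) (at x)"
      "(g has_derivative frechet_derivative g (at x)) (at x)"
      using Suc.prems by (simp_all add: frechet_derivative_works)
    from partial_deriv_eq[OF has_derivative_mult[OF this]]
    show "partial_deriv i (\<lambda>x. f x * g x) x = f x * partial_deriv i g x + partial_deriv i f x * g x"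
      by (simp add: partial_deriv_def)
  qed
  moreover have "Ck k f" "Ck k g"
    using Suc.prems by (blast intro: Ck_Suc_imp_Ck)+
  ultimately show ?case using Suc by (auto intro!: differentiable_mult Ck_add)
qed

lemma Ck_prod: "(\<And>i. i \<in> A \<Longrightarrow> Ck k (f i)) \<Longrightarrow> Ck k (\<lambda>x. \<Prod>i\<in>A. f i x)"
  by (induction A rule: infinite_finite_induct) (simp_all add: Ck_const Ck_mult)

lemma partial_deriv_translate:
  assumes "f differentiable (at (x + a))"
  shows "partial_deriv i (\<lambda>x. f (x + a)) x = partial_deriv i f (x + a)"
proof -
  have "(f has_derivative frechet_derivative f (at (x + a))) (at (x + a))"
    using assms by (simp add: frechet_derivative_works)
  moreover have "((\<lambda>x. x + a) has_derivative (\<lambda>x. x)) (at x)"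
    by (auto intro!: derivative_eq_intros)
  ultimately have "((\<lambda>x. f (x + a)) has_derivative frechet_derivative f (at (x + a))) (at x)"
    by (rule has_derivative_compose[rotated])
  from partial_deriv_eq[OF this] show ?thesis by (simp add: partial_deriv_def)
qed

lemma Ck_translate: "Ck k f \<Longrightarrow> Ck k (\<lambda>x. f (x + a))"
proof (induction k arbitrary: f)
  case 0
  then show ?case by (auto intro!: continuous_on_compose2[of UNIV f] continuous_intros)
next
  case (Suc k)
  then have d: "f differentiable (at x)" for x by simp
  have "(\<lambda>x. f (x + a)) differentiable (at x)" for x
    by (rule differentiable_compose[of f "\<lambda>x. x + a"]) (use d in auto)
  moreover have "partial_deriv i (\<lambda>x. f (x + a)) = (\<lambda>x. partial_deriv i f (x + a))" for i
    using partial_deriv_translate[OF d] by blast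
  ultimately show ?case using Suc by simp
qed

lemma test_functions_translate:
  assumes "\<phi> \<in> test_functions"
  shows "(\<lambda>x. \<phi> (x + a)) \<in> test_functions"
proof -
  have "{x. \<phi> (x + a) \<noteq> 0} = (\<lambda>x. - a + x) ` {x. \<phi> x \<noteq> 0}"
    by (force simp: image_iff intro: exI[of _ "_ + a"])
  with assms show ?thesis
    by (simp add: test_functions_def Ck_translate closure_translation bounded_translation_minus)
qed

lemma continuous_compact_support_bounded:
  fixes f :: "'a::euclidean_space \<Rightarrow> real"
  assumes "continuous_on UNIV f" "compact (closure {x. f x \<noteq> 0})"
  obtains B where "0 < B" "\<And>x. \<bar>f x\<bar> \<le> B * indicator (closure {x. f x \<noteq> 0}) x"
proof -
  have "bounded (f ` closure {x. f x \<noteq> 0})"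
    using assms by (intro compact_imp_bounded compact_continuous_image)
      (auto intro: continuous_on_subset)
  then obtain B where B: "0 < B" "\<And>x. x \<in> closure {x. f x \<noteq> 0} \<Longrightarrow> \<bar>f x\<bar> \<le> B"
    by (auto simp: bounded_pos)
  show thesis
  proof (rule that[OF B(1)])
    fix x
    have "f x = 0" if "x \<notin> closure {x. f x \<noteq> 0}"
      using that closure_subset[of "{x. f x \<noteq> 0}"] by blast
    with B(2) show "\<bar>f x\<bar> \<le> B * indicator (closure {x. f x \<noteq> 0}) x"
      by (auto simp: indicator_def)
  qed
qed

text \<open>Off the closed support f is locally zero, hence differentiable with derivative 0. This
  covers arbitrary f, including points of the support where \<open>frechet_derivative\<close> is an
  unspecified choice.\<close>

lemma partial_deriv_support:
  "closure {x. partial_deriv i f x \<noteq> 0} \<subseteq> closure {x. f x \<noteq> 0}"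
proof (rule closure_minimal)
  show "{x. partial_deriv i f x \<noteq> 0} \<subseteq> closure {x. f x \<noteq> 0}"
  proof
    fix x assume x: "x \<in> {x. partial_deriv i f x \<noteq> 0}"
    show "x \<in> closure {x. f x \<noteq> 0}"
    proof (rule ccontr)
      assume n: "x \<notin> closure {x. f x \<noteq> 0}"
      have "(f has_derivative (\<lambda>_. 0)) (at x)"
        by (rule has_derivative_transform_within_open[where f="\<lambda>_. 0" and s="- closure {x. f x \<noteq> 0}"])
          (use n closure_subset[of "{x. f x \<noteq> 0}"] in auto)
      from partial_deriv_eq[OF this] x show False by simp
    qed
  qed
qed simp

lemma test_functions_partial_deriv:
  assumes "\<phi> \<in> test_functions"
  shows "partial_deriv i \<phi> \<in> test_functions"
proof -
  have "Ck (Suc k) \<phi>" for k using assms by (simp add: test_functions_def)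
  then have "Ck k (partial_deriv i \<phi>)" for k by simp
  moreover have "bounded (closure {x. partial_deriv i \<phi> x \<noteq> 0})"
    using assms by (intro bounded_subset[OF _ partial_deriv_support])
      (simp add: test_functions_def bounded_closure)
  ultimately show ?thesis by (simp add: test_functions_def bounded_subset[OF _ closure_subset])
qed

lemma test_function_bounded:
  assumes "\<phi> \<in> test_functions"
  obtains B K where "0 < B" "compact K" "\<And>x. \<bar>\<phi> x\<bar> \<le> B * indicator K x"
proof -
  have *: "continuous_on UNIV \<phi>" "compact (closure {x. \<phi> x \<noteq> 0})"
    using assms by (auto simp: test_functions_def intro: Ck_imp_continuous_on)
  from continuous_compact_support_bounded[OF *] obtain B where
    "0 < B" "\<And>x. \<bar>\<phi> x\<bar> \<le> B * indicator (closure {x. \<phi> x \<noteq> 0}) x"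
    by blast
  with *(2) show thesis by (intro that)
qed

lemma borel_measurable_test_function:
  "\<phi> \<in> test_functions \<Longrightarrow> \<phi> \<in> borel_measurable borel"
  by (auto simp: test_functions_def intro!: borel_measurable_continuous_onI Ck_imp_continuous_on)

section \<open>The fundamental lemma of the calculus of variations\<close>

text \<open>The case m = 0 is the classical smooth function that vanishes to infinite order at 0.
  The powers of t in the denominator are included because they arise under differentiation, which
  makes the span of the family closed under derivatives.\<close>

definition flat :: "nat \<Rightarrow> real \<Rightarrow> real" where
  "flat m t = (if 0 < t then exp (- 1 / t) / t ^ m else 0)"

lemma flat_nonneg: "0 \<le> flat m t" and flat_0_le_1: "flat 0 t \<le> 1"
  by (auto simp: flat_def)

lemma flat_tendsto_0: "(flat m \<longlongrightarrow> 0) (at 0)"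
proof (rule filterlim_split_at)
  show "(flat m \<longlongrightarrow> 0) (at_left 0)"
    by (rule tendsto_eventually) (auto simp: eventually_at_filter flat_def)
  have "((\<lambda>t::real. inverse t ^ m / exp (inverse t)) \<longlongrightarrow> 0) (at_right 0)"
    by (rule filterlim_compose[OF tendsto_power_div_exp_0 filterlim_inverse_at_top_right])
  moreover have "\<forall>\<^sub>F t in at_right 0. inverse t ^ m / exp (inverse t) = flat m t"
    by (auto simp: eventually_at_filter flat_def exp_minus field_simps power_inverse)
  ultimately show "(flat m \<longlongrightarrow> 0) (at_right 0)"
    by (rule Lim_transform_eventually)
qed

lemma DERIV_flat: "(flat m has_real_derivative flat (m + 2) t - m * flat (m + 1) t) (at t)"
proof -
  consider "t > 0" | "t < 0" | "t = 0" by linarith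
  then show ?thesis
  proof cases
    case 1
    have "((\<lambda>t. exp (- inverse t) * inverse t ^ m) has_real_derivative
        exp (- inverse t) * inverse t ^ 2 * inverse t ^ m -
        exp (- inverse t) * (m * inverse t ^ (m - 1) * inverse t ^ 2)) (at t)"
      using 1 by (auto intro!: derivative_eq_intros simp: power2_eq_square)
    also have "exp (- inverse t) * inverse t ^ 2 * inverse t ^ m -
        exp (- inverse t) * (m * inverse t ^ (m - 1) * inverse t ^ 2) =
        flat (m + 2) t - m * flat (m + 1) t"
      using 1 by (cases m) (simp_all add: flat_def divide_inverse power_inverse power2_eq_square)
    finally show ?thesis
      by (rule has_field_derivative_transform_within_open[where S="{0<..}"]) (use 1 in \<open>auto simp: flat_def divide_inverse power_inverse\<close>)
  next
    case 2
    have "((\<lambda>t. 0) has_real_derivative 0) (at t)" by simp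
    then have "(flat m has_real_derivative 0) (at t)"
      by (rule has_field_derivative_transform_within_open[where S="{..<0}"]) (use 2 in \<open>auto simp: flat_def\<close>)
    with 2 show ?thesis by (simp add: flat_def)
  next
    case 3
    \<comment> \<open>Since \<open>flat m 0 = 0\<close>, the difference quotient at 0 is the next
      member of the family, also at h = 0, where division by zero gives 0. Its limit is already
      known.\<close>
    have "(\<lambda>h. (flat m (0 + h) - flat m 0) / h) = flat (m + 1)"
      by (auto simp: flat_def)
    moreover have "flat (m + 2) 0 - m * flat (m + 1) 0 = 0"
      by (simp add: flat_def)
    ultimately show ?thesis
      unfolding 3 DERIV_def using flat_tendsto_0[of "m + 1"] by simp
  qed
qed

text \<open>The derivative is a combination of \<open>flat (m + 2)\<close> and
  \<open>flat (m + 1)\<close> at the same affine argument, so the induction must run over all m at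
  once. A negative \<alpha> is allowed because the upper faces of a box enter through b - x.\<close>

lemma Ck_flat_affine: "Ck k (\<lambda>x::real^'n. flat m (\<alpha> * x $ i + \<beta>))"
proof (induction k arbitrary: m)
  case 0
  have "continuous_on UNIV (flat m)"
    using DERIV_flat by (auto intro!: continuous_at_imp_continuous_on DERIV_isCont)
  then show ?case
    by (auto intro!: continuous_on_compose2[of UNIV "flat m"] continuous_intros)
next
  case (Suc k)
  let ?d = "\<lambda>x::real^'n. flat (m + 2) (\<alpha> * x $ i + \<beta>) + (- m) * flat (m + 1) (\<alpha> * x $ i + \<beta>)"
  have D: "((\<lambda>x. flat m (\<alpha> * x $ i + \<beta>)) has_derivative (\<lambda>v. ?d x * (\<alpha> * v $ i))) (at x)"
    for x :: "real^'n"
  proof -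
    have "((\<lambda>x::real^'n. \<alpha> * x $ i + \<beta>) has_derivative (\<lambda>v. \<alpha> * v $ i)) (at x)"
      by (auto intro!: derivative_eq_intros bounded_linear.has_derivative[OF bounded_linear_vec_nth])
    from has_derivative_compose[OF this DERIV_flat[unfolded has_field_derivative_def]]
    show ?thesis by simp
  qed
  have "Ck k ?d"
    by (intro Ck_add Ck_mult Ck_const Suc)
  then have "Ck k (\<lambda>x. ?d x * (\<alpha> * axis j 1 $ i))" for j
    by (intro Ck_mult Ck_const)
  then have "Ck k (partial_deriv j (\<lambda>x. flat m (\<alpha> * x $ i + \<beta>)))" for j
    using partial_deriv_eq[OF D] by presburger
  with D show ?case by (auto simp: differentiable_def)
qed

lemma flat_0_scaled_tendsto: "(\<lambda>n. flat 0 (real (Suc n) * t)) \<longlonglongrightarrow> of_bool (0 < t)"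
proof (cases "0 < t")
  case True
  have "(\<lambda>n. exp (- (inverse (real (Suc n)) / t))) \<longlonglongrightarrow> exp (- (0 / t))"
    by (intro tendsto_intros LIMSEQ_inverse_real_of_nat) (use True in simp)
  moreover have "flat 0 (real (Suc n) * t) = exp (- (inverse (real (Suc n)) / t))" for n
    using True by (simp add: flat_def field_simps del: of_nat_Suc)
  ultimately show ?thesis using True by simp
next
  case False
  then have "flat 0 (real (Suc n) * t) = 0" for n
    by (simp add: flat_def zero_less_mult_iff)
  with False show ?thesis by simp
qed

text \<open>Smooth functions increasing to the indicator of the open box as \<open>n \<longlonglongrightarrow> \<infinity>\<close>.\<close>

definition box_bump :: "real^'n::finite \<Rightarrow> real^'n \<Rightarrow> nat \<Rightarrow> real^'n \<Rightarrow> real" where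
  "box_bump a b n x =
     (\<Prod>i\<in>UNIV. flat 0 (Suc n * (x $ i - a $ i)) * flat 0 (Suc n * (b $ i - x $ i)))"

lemma box_bump_bounds: "0 \<le> box_bump a b n x" "box_bump a b n x \<le> indicator (box a b) x"
proof -
  show "0 \<le> box_bump a b n x"
    unfolding box_bump_def by (intro prod_nonneg mult_nonneg_nonneg flat_nonneg)
  show "box_bump a b n x \<le> indicator (box a b) x"
  proof (cases "x \<in> box a b")
    case True
    have "box_bump a b n x \<le> 1"
      unfolding box_bump_def by (intro prod_le_1 conjI mult_nonneg_nonneg mult_le_one flat_nonneg flat_0_le_1)
    with True show ?thesis by simp
  next
    case False
    then obtain i where "x $ i - a $ i \<le> 0 \<or> b $ i - x $ i \<le> 0"
      by (force simp: mem_box_cart not_less)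
    then have "flat 0 (Suc n * (x $ i - a $ i)) * flat 0 (Suc n * (b $ i - x $ i)) = 0"
      by (auto simp: flat_def zero_less_mult_iff)
    then have "box_bump a b n x = 0"
      unfolding box_bump_def by (intro prod_zero) auto
    then show ?thesis by simp
  qed
qed

lemma box_bump_test_functions: "box_bump a b n \<in> test_functions"
proof -
  have "Ck k (box_bump a b n)" for k
  proof -
    have "Ck k (\<lambda>x. \<Prod>i\<in>UNIV. flat 0 (Suc n * x $ i + (- (Suc n * a $ i))) *
        flat 0 (- Suc n * x $ i + Suc n * b $ i))"
      by (intro Ck_prod Ck_mult Ck_flat_affine)
    moreover have "(\<lambda>x. \<Prod>i\<in>UNIV. flat 0 (Suc n * x $ i + (- (Suc n * a $ i))) *
        flat 0 (- Suc n * x $ i + Suc n * b $ i)) = box_bump a b n"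
      unfolding box_bump_def by (intro ext prod.cong arg_cong2[where f="(*)"] arg_cong[where f="flat 0"])
        (simp_all add: algebra_simps)
    ultimately show ?thesis by simp
  qed
  moreover have "{x. box_bump a b n x \<noteq> 0} \<subseteq> box a b"
  proof (intro subsetI, rule ccontr)
    fix x assume "x \<in> {x. box_bump a b n x \<noteq> 0}" "x \<notin> box a b"
    then show False using box_bump_bounds[of a b n x] by simp
  qed
  then have "bounded {x. box_bump a b n x \<noteq> 0}"
    using bounded_box bounded_subset by blast
  ultimately show ?thesis
    by (simp add: test_functions_def compact_closure)
qed

lemma box_bump_tendsto: "(\<lambda>n. box_bump a b n x) \<longlonglongrightarrow> indicator (box a b) x"
proof -
  have "(\<lambda>n. box_bump a b n x) \<longlonglongrightarrow>
      (\<Prod>i\<in>UNIV. of_bool (0 < x $ i - a $ i) * of_bool (0 < b $ i - x $ i))"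
    unfolding box_bump_def by (intro tendsto_prod tendsto_mult flat_0_scaled_tendsto)
  also have "(\<Prod>i\<in>UNIV. of_bool (0 < x $ i - a $ i) * of_bool (0 < b $ i - x $ i)) =
      (indicator (box a b) x :: real)"
  proof (cases "x \<in> box a b")
    case True
    then show ?thesis by (simp add: mem_box_cart)
  next
    case False
    then obtain i where "of_bool (0 < x $ i - a $ i) * of_bool (0 < b $ i - x $ i) = (0::real)"
      by (force simp: mem_box_cart not_less)
    then have "(\<Prod>i\<in>UNIV. of_bool (0 < x $ i - a $ i) * of_bool (0 < b $ i - x $ i)) = (0::real)"
      by (intro prod_zero) auto
    with False show ?thesis by simp
  qed
  finally show ?thesis .
qed

section \<open>Functions whose integrals vanish against all boxes or all test functions\<close>

text \<open>Open boxes form an intersection-stable generator of the Borel sets, so a Dynkin class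
  argument extends the vanishing to all Borel sets. Since w is only locally integrable, the argument
  runs inside a large box \<open>Q n\<close>, where complements and countable unions have convergent
  integrals; countably many such boxes exhaust the space.\<close>

lemma AE_zero_if_box_integrals_zero:
  fixes w :: "'a::euclidean_space \<Rightarrow> 'b::euclidean_space"
  assumes int: "\<And>a b. set_integrable lborel (cbox a b) w"
    and zero: "\<And>a b. (LINT x:box a b|lborel. w x) = 0"
  shows "AE x in lborel. w x = 0"
proof -
  define Q :: "nat \<Rightarrow> 'a set" where "Q n = box (- real n *\<^sub>R One) (real n *\<^sub>R One)" for n
  have "AE x in lborel. indicator (Q n) x *\<^sub>R w x = 0" for n
  proof (rule sigma_finite_measure.density_zero[OF sigma_finite_lborel])
    let ?v = "\<lambda>x. indicator (Q n) x *\<^sub>R w x"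
    have "set_integrable lborel (Q n) w"
      unfolding Q_def by (rule set_integrable_subset[OF int _ box_subset_cbox]) simp
    then show v: "integrable lborel ?v"
      by (simp add: set_integrable_def)
    then have vs: "set_integrable lborel A ?v" if "A \<in> sets borel" for A
      using that unfolding set_integrable_def by (intro integrable_mult_indicator[OF _ v]) simp
    fix A :: "'a set" assume "A \<in> sets lborel"
    then have A: "A \<in> sigma_sets UNIV (range (\<lambda>(a, b). box a b))"
      by (simp add: borel_eq_box)
    have Int: "Int_stable (range (\<lambda>(a, b). box a b :: 'a set))"
      by (auto simp: Int_stable_def box_Int_box)
    have Pow: "range (\<lambda>(a, b). box a b :: 'a set) \<subseteq> Pow UNIV"
      by simp
    from Int Pow A
    have "A \<in> sets borel \<and> (LINT x:A|lborel. ?v x) = 0"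
    proof (induction rule: sigma_sets_induct_disjoint)
      case (basic A)
      then obtain a b where A: "A = box a b" by auto
      \<comment> \<open>The hypothesis concerns w and not its restriction to \<open>Q n\<close>, but
        a box cut with \<open>Q n\<close> is again a box.\<close>
      obtain a' b' where ab: "box a b \<inter> Q n = box a' b'"
        unfolding Q_def box_Int_box by blast
      have "(LINT x:A|lborel. ?v x) = (LINT x:box a' b'|lborel. w x)"
        unfolding A set_lebesgue_integral_def ab[symmetric]
        by (intro Bochner_Integration.integral_cong) (auto simp: indicator_def)
      with zero A show ?case by simp
    next
      case (compl A)
      \<comment> \<open>The integral over the complement of A is the integral over the whole of
        \<open>Q n\<close>, since A contributes 0; and \<open>Q n\<close> is itself a box.\<close>
      have "(LINT x:UNIV|lborel. ?v x) = (LINT x:A \<union> (UNIV - A)|lborel. ?v x)"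
        by simp
      also have "\<dots> = (LINT x:A|lborel. ?v x) + (LINT x:UNIV - A|lborel. ?v x)"
        using compl by (intro set_integral_Un vs) auto
      finally have "(LINT x:UNIV - A|lborel. ?v x) = (LINT x:Q n|lborel. w x)"
        using compl by (simp add: set_lebesgue_integral_def)
      with compl zero show ?case by (auto simp: Q_def)
    next
      case (union F)
      then have "(\<Union>i. F i) \<in> sets borel" by auto
      moreover have "(LINT x:(\<Union>i. F i)|lborel. ?v x) = (\<Sum>i. LINT x:F i|lborel. ?v x)"
        using union by (intro lebesgue_integral_countable_add vs) (auto simp: disjoint_family_on_def)
      ultimately show ?case using union by simp
    qed (simp_all add: set_lebesgue_integral_def)
    then show "(LINT x:A|lborel. ?v x) = 0" by simp
  qed
  then have "AE x in lborel. \<forall>n. indicator (Q n) x *\<^sub>R w x = 0"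
    unfolding AE_all_countable by blast
  moreover have "\<exists>n. x \<in> Q n" for x
  proof -
    obtain n where n: "norm x < real n" using reals_Archimedean2 by blast
    have "\<bar>x \<bullet> i\<bar> < real n" if "i \<in> Basis" for i
      using Basis_le_norm[OF that, of x] n by linarith
    then have "x \<in> Q n" by (force simp: Q_def mem_box)
    then show ?thesis ..
  qed
  ultimately show ?thesis
    by (elim eventually_mono) (metis indicator_simps(1) scaleR_one)
qed

text \<open>Smooth bumps converge pointwise to the indicator of an open box and stay below the
  indicator of the closed box, so local integrability of w provides the dominating function and the
  claim reduces to box integrals.\<close>

lemma AE_zero_if_test_function_integrals_zero:
  fixes w :: "real^'n::finite \<Rightarrow> 'b::euclidean_space"
  assumes int: "\<And>K. compact K \<Longrightarrow> set_integrable lborel K w"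
    and zero: "\<And>\<phi>. \<phi> \<in> test_functions \<Longrightarrow> (\<integral>x. \<phi> x *\<^sub>R w x \<partial>lborel) = 0"
    and meas [measurable]: "w \<in> borel_measurable borel"
  shows "AE x in lborel. w x = 0"
proof (rule AE_zero_if_box_integrals_zero)
  fix a b :: "real^'n"
  show int': "set_integrable lborel (cbox a b) w" by (rule int) simp
  have [measurable]: "box_bump a b n \<in> borel_measurable borel" for n
    by (rule borel_measurable_test_function[OF box_bump_test_functions])
  have "(\<lambda>n. \<integral>x. box_bump a b n x *\<^sub>R w x \<partial>lborel) \<longlonglongrightarrow> (\<integral>x. indicator (box a b) x *\<^sub>R w x \<partial>lborel)"
  proof (rule integral_dominated_convergence)
    show "integrable lborel (\<lambda>x. norm (indicator (cbox a b) x *\<^sub>R w x))"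
      using int' unfolding set_integrable_def by (rule integrable_norm)
    show "AE x in lborel. (\<lambda>n. box_bump a b n x *\<^sub>R w x) \<longlonglongrightarrow> indicator (box a b) x *\<^sub>R w x"
      by (intro AE_I2 tendsto_scaleR box_bump_tendsto tendsto_const)
    fix n
    have "\<bar>box_bump a b n x\<bar> \<le> indicator (cbox a b) x" for x
    proof -
      have "indicator (box a b) x \<le> (indicator (cbox a b) x :: real)"
        using box_subset_cbox[of a b] by (auto simp: indicator_def)
      with box_bump_bounds[of a b n x] show ?thesis by linarith
    qed
    then show "AE x in lborel. norm (box_bump a b n x *\<^sub>R w x) \<le> norm (indicator (cbox a b) x *\<^sub>R w x)"
      by (auto intro!: AE_I2 mult_right_mono)
  qed measurable
  moreover have "(\<integral>x. box_bump a b n x *\<^sub>R w x \<partial>lborel) = 0" for n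
    by (intro zero box_bump_test_functions)
  ultimately show "(LINT x:box a b|lborel. w x) = 0"
    by (simp add: set_lebesgue_integral_def LIMSEQ_const_iff)
qed

section \<open>Weak gradients\<close>

lemma Lp_space_2_iff:
  "f \<in> Lp_space 2 \<longleftrightarrow> f \<in> borel_measurable borel \<and> integrable lborel (\<lambda>x. (norm (f x))\<^sup>2)"
  by (simp add: Lp_space_def)

lemma Lp_norm_2_squared: "(Lp_norm 2 f)\<^sup>2 = (\<integral>x. (norm (f x))\<^sup>2 \<partial>lborel)"
proof -
  have "0 \<le> (\<integral>x. (norm (f x))\<^sup>2 \<partial>lborel)" by simp
  then show ?thesis by (simp add: Lp_norm_def powr_half_sqrt)
qed

lemma integrable_indicator_compact:
  fixes K :: "'a::euclidean_space set"
  assumes "compact K"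
  shows "integrable lborel (indicator K :: 'a \<Rightarrow> real)"
  using assms emeasure_compact_finite[OF assms]
  by (intro integrable_real_indicator) (simp_all add: borel_compact less_top)

lemma test_functions_subset_Lp_space: "\<phi> \<in> test_functions \<Longrightarrow> \<phi> \<in> Lp_space 2"
proof -
  assume \<phi>: "\<phi> \<in> test_functions"
  then obtain B K where B: "0 < B" "compact K" "\<And>x. \<bar>\<phi> x\<bar> \<le> B * indicator K x"
    using test_function_bounded by blast
  note [measurable] = borel_measurable_test_function[OF \<phi>]
  have "integrable lborel (\<lambda>x. B\<^sup>2 * indicator K x :: real)"
    using B(2) by (intro integrable_mult_right integrable_indicator_compact)
  then have "integrable lborel (\<lambda>x. (\<phi> x)\<^sup>2)"
  proof (rule Bochner_Integration.integrable_bound)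
    have "(\<phi> x)\<^sup>2 \<le> B\<^sup>2 * indicator K x" for x
      using power_mono[OF B(3)[of x], of 2] by (cases "x \<in> K") simp_all
    then show "AE x in lborel. norm ((\<phi> x)\<^sup>2) \<le> norm (B\<^sup>2 * indicator K x)"
      by (intro AE_I2) simp
  qed measurable
  then show ?thesis by (simp add: Lp_space_2_iff borel_measurable_test_function[OF \<phi>])
qed

lemma integrable_test_function_scaleR:
  assumes f: "locally_integrable f" and \<phi>: "\<phi> \<in> test_functions"
  shows "integrable lborel (\<lambda>x. \<phi> x *\<^sub>R f x)"
proof -
  obtain B K where B: "0 < B" "compact K" "\<And>x. \<bar>\<phi> x\<bar> \<le> B * indicator K x"
    using \<phi> test_function_bounded by blast
  note [measurable] = borel_measurable_test_function[OF \<phi>]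
  have [measurable]: "f \<in> borel_measurable borel" using f by (simp add: locally_integrable_def)
  have "integrable lborel (\<lambda>x. B *\<^sub>R (indicator K x *\<^sub>R f x))"
    using f B(2) unfolding locally_integrable_def set_integrable_def
    by (intro integrable_scaleR_right) blast
  then show ?thesis
  proof (rule Bochner_Integration.integrable_bound)
    show "AE x in lborel. norm (\<phi> x *\<^sub>R f x) \<le> norm (B *\<^sub>R (indicator K x *\<^sub>R f x))"
    proof (rule AE_I2)
      fix x
      have "\<bar>\<phi> x\<bar> * norm (f x) \<le> (B * indicator K x) * norm (f x)"
        by (intro mult_right_mono B(3)) simp
      then show "norm (\<phi> x *\<^sub>R f x) \<le> norm (B *\<^sub>R (indicator K x *\<^sub>R f x))"
        using B(1) by (simp add: mult.assoc)
    qed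
  qed measurable
qed

lemma locally_integrable_nth:
  fixes g :: "R3 \<Rightarrow> complex ^ 3"
  assumes "locally_integrable g"
  shows "locally_integrable (\<lambda>x. g x $ i)"
proof -
  have [measurable]: "g \<in> borel_measurable borel"
    using assms by (simp add: locally_integrable_def)
  have [measurable]: "(\<lambda>x. g x $ i) \<in> borel_measurable borel"
    by (intro borel_measurable_continuous_on[where f="\<lambda>v. v $ i"] continuous_intros) measurable
  have "set_integrable lborel K (\<lambda>x. g x $ i)" if "compact K" for K
  proof -
    have [measurable]: "K \<in> sets borel" using that by (rule borel_compact)
    have "integrable lborel (\<lambda>x. indicator K x *\<^sub>R g x)"
      using assms that unfolding locally_integrable_def set_integrable_def by blast
    then show ?thesis
      unfolding set_integrable_def
    proof (rule Bochner_Integration.integrable_bound)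
      show "AE x in lborel. norm (indicator K x *\<^sub>R g x $ i) \<le> norm (indicator K x *\<^sub>R g x)"
        unfolding norm_scaleR
        by (intro AE_I2 mult_left_mono Finite_Cartesian_Product.norm_nth_le) simp
    qed measurable
  qed
  then show ?thesis
    by (simp add: locally_integrable_def)
qed

lemma Lp_space_nth:
  fixes g :: "R3 \<Rightarrow> complex ^ 3"
  assumes "g \<in> Lp_space 2"
  shows "(\<lambda>x. g x $ i) \<in> Lp_space 2"
proof -
  have [measurable]: "g \<in> borel_measurable borel"
    using assms by (simp add: Lp_space_2_iff)
  have [measurable]: "(\<lambda>x. g x $ i) \<in> borel_measurable borel"
    by (intro borel_measurable_continuous_on[where f="\<lambda>v. v $ i"] continuous_intros) measurable
  have "integrable lborel (\<lambda>x. (norm (g x $ i))\<^sup>2)"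
    using assms unfolding Lp_space_2_iff
    by (auto intro!: Bochner_Integration.integrable_bound[where f="\<lambda>x. (norm (g x))\<^sup>2"]
        power_mono Finite_Cartesian_Product.norm_nth_le)
  then show ?thesis by (simp add: Lp_space_2_iff)
qed

section \<open>Translates and the uniqueness of the weak gradient\<close>

lemma locally_integrable_translate:
  assumes "locally_integrable f"
  shows "locally_integrable (\<lambda>x. f (x + a))"
proof -
  have [measurable]: "f \<in> borel_measurable borel"
    using assms by (simp add: locally_integrable_def)
  have "set_integrable lborel K (\<lambda>x. f (x + a))" if "compact K" for K
  proof -
    have "compact ((\<lambda>x. a + x) ` K)"
      using that by (rule compact_translation)
    then have "integrable lborel (\<lambda>x. indicator ((\<lambda>x. a + x) ` K) x *\<^sub>R f x)"
      using assms by (simp add: locally_integrable_def set_integrable_def)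
    then have "integrable lborel (\<lambda>x. indicator ((\<lambda>x. a + x) ` K) (x + a) *\<^sub>R f (x + a))"
      by (rule integrable_lborel_translate_iff[THEN iffD2])
    moreover have "indicator ((\<lambda>x. a + x) ` K) (x + a) = (indicator K x :: real)" for x
      by (auto simp: indicator_def add.commute)
    ultimately show ?thesis by (simp add: set_integrable_def)
  qed
  then show ?thesis by (simp add: locally_integrable_def)
qed

lemma Lp_space_translate: "f \<in> Lp_space q \<Longrightarrow> (\<lambda>x. f (x + a)) \<in> Lp_space q"
  using integrable_lborel_translate_iff[of "\<lambda>x. norm (f x) powr q" a]
  by (auto simp: Lp_space_def)

lemma Lp_norm_translate: "Lp_norm q (\<lambda>x. f (x + a)) = Lp_norm q f"
  using integral_lborel_translate[of "\<lambda>x. norm (f x) powr q" a]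
  by (simp add: Lp_norm_def)

text \<open>A change of variables moves the shift onto the test function, where it commutes with the
  partial derivative.\<close>

lemma is_weak_gradient_translate:
  assumes "is_weak_gradient u g"
  shows "is_weak_gradient (\<lambda>x. u (x + a)) (\<lambda>x. g (x + a))"
  unfolding is_weak_gradient_def
proof (intro conjI ballI allI)
  show "locally_integrable (\<lambda>x. u (x + a))" "locally_integrable (\<lambda>x. g (x + a))"
    using assms unfolding is_weak_gradient_def by (blast intro: locally_integrable_translate)+
  fix \<phi> :: "R3 \<Rightarrow> real" and i
  assume \<phi>: "\<phi> \<in> test_functions"
  then have "Ck (Suc 0) \<phi>"
    unfolding test_functions_def by blast
  then have d: "\<phi> differentiable at x" for x by simp
  have "(\<integral>x. partial_deriv i \<phi> x *\<^sub>R u (x + a) \<partial>lborel) =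
      (\<integral>x. partial_deriv i \<phi> (x + - a) *\<^sub>R u x \<partial>lborel)"
    using integral_lborel_translate[of "\<lambda>x. partial_deriv i \<phi> (x + - a) *\<^sub>R u x" a] by simp
  also have "\<dots> = (\<integral>x. partial_deriv i (\<lambda>x. \<phi> (x + - a)) x *\<^sub>R u x \<partial>lborel)"
    by (simp only: partial_deriv_translate[OF d])
  also have "\<dots> = - (\<integral>x. \<phi> (x + - a) *\<^sub>R g x $ i \<partial>lborel)"
    using assms test_functions_translate[OF \<phi>, of "- a"] by (simp add: is_weak_gradient_def)
  also have "\<dots> = - (\<integral>x. \<phi> x *\<^sub>R g (x + a) $ i \<partial>lborel)"
    using integral_lborel_translate[of "\<lambda>x. \<phi> (x + - a) *\<^sub>R g x $ i" a] by simp
  finally show "(\<integral>x. partial_deriv i \<phi> x *\<^sub>R u (x + a) \<partial>lborel) =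
      - (\<integral>x. \<phi> x *\<^sub>R g (x + a) $ i \<partial>lborel)" .
qed

lemma is_weak_gradient_unique:
  assumes "is_weak_gradient u g" "is_weak_gradient u h"
  shows "AE x in lborel. g x = h x"
proof -
  have "AE x in lborel. g x $ i - h x $ i = 0" for i
  proof (rule AE_zero_if_test_function_integrals_zero)
    have li: "locally_integrable (\<lambda>x. g x $ i)" "locally_integrable (\<lambda>x. h x $ i)"
      using assms unfolding is_weak_gradient_def by (blast intro: locally_integrable_nth)+
    then show "(\<lambda>x. g x $ i - h x $ i) \<in> borel_measurable borel"
      by (auto simp: locally_integrable_def)
    show "set_integrable lborel K (\<lambda>x. g x $ i - h x $ i)" if "compact K" for K
      using li that unfolding locally_integrable_def by (intro set_integral_diff(1)) blast+
    fix \<phi> :: "R3 \<Rightarrow> real" assume \<phi>: "\<phi> \<in> test_functions"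
    have "- (\<integral>x. \<phi> x *\<^sub>R g x $ i \<partial>lborel) = - (\<integral>x. \<phi> x *\<^sub>R h x $ i \<partial>lborel)"
      using assms \<phi> by (simp add: is_weak_gradient_def)
    then show "(\<integral>x. \<phi> x *\<^sub>R (g x $ i - h x $ i) \<partial>lborel) = 0"
      using integrable_test_function_scaleR[OF li(1) \<phi>] integrable_test_function_scaleR[OF li(2) \<phi>]
      by (simp add: scaleR_diff_right)
  qed
  then have "AE x in lborel. \<forall>i. g x $ i - h x $ i = 0"
    unfolding AE_all_countable by blast
  then show ?thesis by (simp add: vec_eq_iff)
qed

lemma is_weak_gradient_weak_gradient:
  "is_weak_gradient u g \<Longrightarrow> is_weak_gradient u (weak_gradient u)"
  unfolding weak_gradient_def by (rule someI[where P="is_weak_gradient u"])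

lemma is_weak_gradient_borel_measurable:
  "is_weak_gradient u g \<Longrightarrow> u \<in> borel_measurable borel"
  "is_weak_gradient u g \<Longrightarrow> g \<in> borel_measurable borel"
  by (simp_all add: is_weak_gradient_def locally_integrable_def)

lemma Lp_norm_cong_AE:
  assumes "f \<in> borel_measurable borel" "g \<in> borel_measurable borel"
    and "AE x in lborel. f x = g x"
  shows "Lp_norm q f = Lp_norm q g"
proof -
  note [measurable] = assms(1,2)
  have "(\<integral>x. norm (f x) powr q \<partial>lborel) = (\<integral>x. norm (g x) powr q \<partial>lborel)"
    by (rule integral_cong_AE) (use assms(3) in auto)
  then show ?thesis by (simp add: Lp_norm_def)
qed

text \<open>\<open>weak_gradient\<close> is a Hilbert choice, so its value at a translate of u need
  not be the translate of its value at u. Uniqueness up to null sets allows any explicit weak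
  gradient to be used inside a norm.\<close>

lemma Lp_norm_weak_gradient:
  assumes "is_weak_gradient u g"
  shows "Lp_norm q (weak_gradient u) = Lp_norm q g"
  using is_weak_gradient_unique[OF is_weak_gradient_weak_gradient[OF assms] assms]
  by (intro Lp_norm_cong_AE is_weak_gradient_borel_measurable[OF assms]
      is_weak_gradient_borel_measurable[OF is_weak_gradient_weak_gradient[OF assms]])

section \<open>Difference quotients\<close>

text \<open>The two shifts are independent so that the lemma applies both to the derivative of the
  shifted test function against \<open>u\<close> and to the test function against the shifted gradient.\<close>

lemma integrable_shifted_product:
  fixes \<psi> :: "R3 \<Rightarrow> real" and f :: "R3 \<Rightarrow> 'b::euclidean_space"
  assumes \<psi>: "\<psi> \<in> Lp_space 2" and f: "f \<in> Lp_space 2"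
  shows "integrable (lborel \<Otimes>\<^sub>M lborel)
    (\<lambda>(s::real, x). indicator {0..h} s *\<^sub>R (\<psi> (x + s *\<^sub>R a) *\<^sub>R f (x + s *\<^sub>R b)))"
    (is "integrable _ (\<lambda>(s, x). ?F s x)")
proof (rule lborel_pair.Fubini_integrable)
  have [measurable]: "\<psi> \<in> borel_measurable borel" "f \<in> borel_measurable borel"
    using assms by (simp_all add: Lp_space_2_iff)
  show "(\<lambda>(s, x). ?F s x) \<in> borel_measurable (lborel \<Otimes>\<^sub>M lborel)"
    by measurable
  \<comment> \<open>AM-GM bounds the product by a sum of squares whose x-integral is, by translation
    invariance, the same constant \<open>?C\<close> for every s. The s-integral over the compact
    interval is then finite.\<close>
  let ?G = "\<lambda>s x. ((\<psi> (x + s *\<^sub>R a))\<^sup>2 + (norm (f (x + s *\<^sub>R b)))\<^sup>2) :: real"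
  let ?C = "(\<integral>x. (\<psi> x)\<^sup>2 \<partial>lborel) + (\<integral>x. (norm (f x))\<^sup>2 \<partial>lborel)"
  have \<psi>2: "integrable lborel (\<lambda>x. (\<psi> (x + s *\<^sub>R a))\<^sup>2)" for s
    using \<psi> integrable_lborel_translate_iff[of "\<lambda>x. (\<psi> x)\<^sup>2"] by (simp add: Lp_space_2_iff)
  have f2: "integrable lborel (\<lambda>x. (norm (f (x + s *\<^sub>R b)))\<^sup>2)" for s
    using f integrable_lborel_translate_iff[of "\<lambda>x. (norm (f x))\<^sup>2"] by (simp add: Lp_space_2_iff)
  have G: "integrable lborel (?G s)" for s
    by (intro Bochner_Integration.integrable_add \<psi>2 f2)
  have intG: "integral\<^sup>L lborel (?G s) = ?C" for s
    using integral_lborel_translate[of "\<lambda>x. (\<psi> x)\<^sup>2" "s *\<^sub>R a"]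
      integral_lborel_translate[of "\<lambda>x. (norm (f x))\<^sup>2" "s *\<^sub>R b"] \<psi>2 f2 by simp
  have le: "norm (\<psi> (x + s *\<^sub>R a) *\<^sub>R f (x + s *\<^sub>R b)) \<le> ?G s x" for s x
  proof -
    have "2 * (\<bar>\<psi> (x + s *\<^sub>R a)\<bar> * norm (f (x + s *\<^sub>R b))) \<le> ?G s x"
      using sum_squares_bound[of "\<bar>\<psi> (x + s *\<^sub>R a)\<bar>" "norm (f (x + s *\<^sub>R b))"] by simp
    moreover have "0 \<le> \<bar>\<psi> (x + s *\<^sub>R a)\<bar> * norm (f (x + s *\<^sub>R b))" by simp
    ultimately show ?thesis unfolding norm_scaleR by linarith
  qed
  have int_x: "integrable lborel (\<lambda>x. \<psi> (x + s *\<^sub>R a) *\<^sub>R f (x + s *\<^sub>R b))" for s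
    using le by (intro Bochner_Integration.integrable_bound[OF G[of s]])
      (auto intro!: AE_I2 intro: order_trans)
  then show "AE s in lborel. integrable lborel (\<lambda>x. case (s, x) of (s, x) \<Rightarrow> ?F s x)"
    unfolding prod.case by (intro AE_I2 integrable_scaleR_right)
  have norm_le: "(\<integral>x. norm (\<psi> (x + s *\<^sub>R a) *\<^sub>R f (x + s *\<^sub>R b)) \<partial>lborel) \<le> ?C" for s
    unfolding intG[of s, symmetric] by (intro integral_mono integrable_norm int_x G le)
  have "integrable lborel (\<lambda>s. ?C * indicator {0..h} s)"
    by (intro integrable_mult_right integrable_indicator_compact compact_Icc)
  then show "integrable lborel (\<lambda>s. \<integral>x. norm (case (s, x) of (s, x) \<Rightarrow> ?F s x) \<partial>lborel)"
  proof (rule Bochner_Integration.integrable_bound)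
    show "AE s in lborel. norm (\<integral>x. norm (case (s, x) of (s, x) \<Rightarrow> ?F s x) \<partial>lborel)
        \<le> norm (?C * indicator {0..h} s)"
      using norm_le by (auto simp: indicator_def intro!: AE_I2 simp del: norm_scaleR)
  qed measurable
qed

text \<open>The fundamental theorem of calculus is applied to the test function and not to u: the
  difference of \<phi> along the axis is an integral of its partial derivative. Fubini and the weak
  gradient of the translates of u turn this into the integral of the translates of g, and the
  fundamental lemma removes \<phi>.\<close>

lemma weak_gradient_difference:
  assumes grad: "is_weak_gradient u g" and u: "u \<in> Lp_space 2" and g: "g \<in> Lp_space 2"
    and h: "0 < h"
  shows "AE x in lborel. u (x + h *\<^sub>R axis i 1) - u x =
    (\<integral>s. indicator {0..h} s *\<^sub>R (g (x + s *\<^sub>R axis i 1) $ i) \<partial>lborel)"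
proof -
  let ?e = "axis i 1 :: R3"
  let ?g = "\<lambda>x. g x $ i"
  define I where "I x = (\<integral>s. indicator {0..h} s *\<^sub>R ?g (x + s *\<^sub>R ?e) \<partial>lborel)" for x
  have gi: "?g \<in> Lp_space 2" by (rule Lp_space_nth[OF g])
  have [measurable]: "u \<in> borel_measurable borel" "?g \<in> borel_measurable borel"
    using u gi by (simp_all add: Lp_space_2_iff)
  have I_meas [measurable]: "I \<in> borel_measurable borel"
    unfolding I_def by measurable
  have lu: "locally_integrable u" "locally_integrable (\<lambda>x. u (x + h *\<^sub>R ?e))"
    using grad unfolding is_weak_gradient_def by (blast intro: locally_integrable_translate)+
  have pair: "integrable (lborel \<Otimes>\<^sub>M lborel)
      (\<lambda>(s, x). indicator {0..h} s *\<^sub>R (\<psi> x *\<^sub>R ?g (x + s *\<^sub>R ?e)))"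
    if "\<psi> \<in> Lp_space 2" for \<psi> :: "R3 \<Rightarrow> real"
    using integrable_shifted_product[OF that gi, of h 0 ?e] by simp
  \<comment> \<open>This holds at every x, including those where the s-integral diverges and both
    sides are 0.\<close>
  have I_eq: "(\<integral>s. indicator {0..h} s *\<^sub>R (c *\<^sub>R ?g (x + s *\<^sub>R ?e)) \<partial>lborel) = c *\<^sub>R I x" for c x
    unfolding I_def scaleR_left_commute[of _ c] by (rule integral_scaleR_right)
  have I_int: "integrable lborel (\<lambda>x. \<psi> x *\<^sub>R I x)"
    if "\<psi> \<in> Lp_space 2" for \<psi> :: "R3 \<Rightarrow> real"
    using lborel_pair.integrable_snd[OF pair[OF that]] unfolding I_eq .
  have "AE x in lborel. (u (x + h *\<^sub>R ?e) - u x) - I x = 0"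
  proof (rule AE_zero_if_test_function_integrals_zero)
    fix K :: "R3 set" assume K: "compact K"
    have "(indicator K :: R3 \<Rightarrow> real) \<in> Lp_space 2"
    proof -
      have "integrable lborel (indicator K :: R3 \<Rightarrow> real)"
        using K by (rule integrable_indicator_compact)
      moreover have "(norm (indicator K x :: real))\<^sup>2 = indicator K x" for x
        by (simp add: indicator_def)
      moreover have "K \<in> sets borel" using K by (simp add: borel_compact)
      ultimately show ?thesis by (simp add: Lp_space_2_iff)
    qed
    then have "set_integrable lborel K I"
      unfolding set_integrable_def by (rule I_int)
    then show "set_integrable lborel K (\<lambda>x. (u (x + h *\<^sub>R ?e) - u x) - I x)"
      using lu K unfolding locally_integrable_def by (intro set_integral_diff(1)) blast+
  next
    fix \<phi> :: "R3 \<Rightarrow> real" assume \<phi>: "\<phi> \<in> test_functions"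
    have "Ck (Suc 0) \<phi>" using \<phi> unfolding test_functions_def by blast
    then have d: "\<phi> differentiable at x" for x by simp
    have cont: "continuous_on UNIV (partial_deriv i \<phi>)"
      using test_functions_partial_deriv[OF \<phi>, of i] Ck_imp_continuous_on
      unfolding test_functions_def by blast
    note \<phi>L = test_functions_subset_Lp_space[OF \<phi>]
    note \<phi>' = test_functions_partial_deriv[OF \<phi>, of i]
    have FTC: "(\<integral>s. indicator {0..h} s *\<^sub>R partial_deriv i \<phi> (x + s *\<^sub>R (- ?e)) \<partial>lborel) =
        \<phi> x - \<phi> (x - h *\<^sub>R ?e)" for x
    proof -
      \<comment> \<open>The test function is followed against the axis direction, which reverses the
        sign of the derivative; hence the antiderivative is -\<phi>.\<close>
      have "((\<lambda>s. - \<phi> (x + s *\<^sub>R (- ?e))) has_vector_derivative partial_deriv i \<phi> (x + s *\<^sub>R (- ?e)))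
          (at s within {0..h})" for s
      proof -
        have d1: "(\<phi> has_derivative frechet_derivative \<phi> (at (x + s *\<^sub>R (- ?e)))) (at (x + s *\<^sub>R (- ?e)))"
          using d by (simp add: frechet_derivative_works)
        have d2: "((\<lambda>s. x + s *\<^sub>R (- ?e)) has_derivative (\<lambda>s. s *\<^sub>R (- ?e))) (at s within {0..h})"
          by (auto intro!: derivative_eq_intros)
        have "((\<lambda>s. - \<phi> (x + s *\<^sub>R (- ?e))) has_derivative
            (\<lambda>t. - frechet_derivative \<phi> (at (x + s *\<^sub>R (- ?e))) (t *\<^sub>R (- ?e)))) (at s within {0..h})"
          by (rule has_derivative_minus[OF has_derivative_compose[OF d2 d1]])
        moreover have "linear (frechet_derivative \<phi> (at (x + s *\<^sub>R (- ?e))))"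
          using d by (rule linear_frechet_derivative)
        then have "- frechet_derivative \<phi> (at (x + s *\<^sub>R (- ?e))) (t *\<^sub>R (- ?e)) =
            t *\<^sub>R partial_deriv i \<phi> (x + s *\<^sub>R (- ?e))" for t
          unfolding partial_deriv_def by (simp only: linear_cmul linear_neg) simp
        ultimately show ?thesis by (simp add: has_vector_derivative_def)
      qed
      then show ?thesis
        using h by (subst integral_FTC_atLeastAtMost[where F="\<lambda>s. - \<phi> (x + s *\<^sub>R (- ?e))"])
          (auto intro!: continuous_on_compose2[OF cont] continuous_intros)
    qed
    have FTC_int: "integrable lborel (\<lambda>s. indicator {0..h} s *\<^sub>R partial_deriv i \<phi> (x + s *\<^sub>R (- ?e)))" for x
      by (intro borel_integrable_compact continuous_on_compose2[OF cont] continuous_intros) auto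
    have "(\<integral>x. (\<phi> x - \<phi> (x - h *\<^sub>R ?e)) *\<^sub>R u x \<partial>lborel) =
        (\<integral>x. (\<integral>s. indicator {0..h} s *\<^sub>R (partial_deriv i \<phi> (x + s *\<^sub>R (- ?e)) *\<^sub>R u x) \<partial>lborel) \<partial>lborel)"
      unfolding FTC[symmetric] integral_scaleR_left[OF FTC_int, symmetric] by simp
    also have "\<dots> = (\<integral>s. (\<integral>x. indicator {0..h} s *\<^sub>R (partial_deriv i \<phi> (x + s *\<^sub>R (- ?e)) *\<^sub>R u x) \<partial>lborel) \<partial>lborel)"
      using lborel_pair.Fubini_integral[OF integrable_shifted_product[OF
        test_functions_subset_Lp_space[OF \<phi>'] u, of h "- ?e" 0]] by simp
    also have "\<dots> = (\<integral>s. - (\<integral>x. indicator {0..h} s *\<^sub>R (\<phi> x *\<^sub>R ?g (x + s *\<^sub>R ?e)) \<partial>lborel) \<partial>lborel)"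
    proof (intro Bochner_Integration.integral_cong refl)
      fix s :: real
      have "(\<integral>x. partial_deriv i \<phi> (x + s *\<^sub>R (- ?e)) *\<^sub>R u x \<partial>lborel) =
          (\<integral>x. partial_deriv i \<phi> x *\<^sub>R u (x + s *\<^sub>R ?e) \<partial>lborel)"
        using integral_lborel_translate[of "\<lambda>x. partial_deriv i \<phi> (x + s *\<^sub>R (- ?e)) *\<^sub>R u x" "s *\<^sub>R ?e"]
        by simp
      also have "\<dots> = - (\<integral>x. \<phi> x *\<^sub>R ?g (x + s *\<^sub>R ?e) \<partial>lborel)"
        using is_weak_gradient_translate[OF grad] \<phi> by (simp add: is_weak_gradient_def)
      finally show "(\<integral>x. indicator {0..h} s *\<^sub>R (partial_deriv i \<phi> (x + s *\<^sub>R (- ?e)) *\<^sub>R u x) \<partial>lborel)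
          = - (\<integral>x. indicator {0..h} s *\<^sub>R (\<phi> x *\<^sub>R ?g (x + s *\<^sub>R ?e)) \<partial>lborel)"
        by (simp only: integral_scaleR_right scaleR_minus_right)
    qed
    also have "\<dots> = - (\<integral>x. (\<integral>s. indicator {0..h} s *\<^sub>R (\<phi> x *\<^sub>R ?g (x + s *\<^sub>R ?e)) \<partial>lborel) \<partial>lborel)"
      using lborel_pair.Fubini_integral[OF pair[OF \<phi>L]] by simp
    also have "\<dots> = - (\<integral>x. \<phi> x *\<^sub>R I x \<partial>lborel)"
      by (simp only: I_eq)
    finally have 1: "(\<integral>x. (\<phi> x - \<phi> (x - h *\<^sub>R ?e)) *\<^sub>R u x \<partial>lborel) = - (\<integral>x. \<phi> x *\<^sub>R I x \<partial>lborel)" .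
    have "(\<integral>x. \<phi> x *\<^sub>R u (x + h *\<^sub>R ?e) \<partial>lborel) = (\<integral>x. \<phi> (x - h *\<^sub>R ?e) *\<^sub>R u x \<partial>lborel)"
      using integral_lborel_translate[of "\<lambda>x. \<phi> (x - h *\<^sub>R ?e) *\<^sub>R u x" "h *\<^sub>R ?e"] by simp
    moreover have "integrable lborel (\<lambda>x. \<phi> (x - h *\<^sub>R ?e) *\<^sub>R u x)"
      using integrable_test_function_scaleR[OF lu(1) test_functions_translate[OF \<phi>, of "- (h *\<^sub>R ?e)"]]
      by simp
    ultimately have "(\<integral>x. \<phi> x *\<^sub>R (u (x + h *\<^sub>R ?e) - u x) \<partial>lborel) = (\<integral>x. \<phi> x *\<^sub>R I x \<partial>lborel)"
      using 1 integrable_test_function_scaleR[OF lu(1) \<phi>] integrable_test_function_scaleR[OF lu(2) \<phi>]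
      by (simp add: scaleR_diff_right scaleR_diff_left algebra_simps)
    then show "(\<integral>x. \<phi> x *\<^sub>R ((u (x + h *\<^sub>R ?e) - u x) - I x) \<partial>lborel) = 0"
      using integrable_test_function_scaleR[OF lu(1) \<phi>] integrable_test_function_scaleR[OF lu(2) \<phi>]
        I_int[OF \<phi>L]
      by (simp add: scaleR_diff_right)
  qed measurable
  then show ?thesis by (simp add: I_def)
qed

text \<open>One factor h comes from Cauchy-Schwarz on [0, h], the other from Tonelli, since every
  translate of g has the same norm. Nonnegative integrals are used throughout so that integrability
  is a result of the estimate.\<close>

lemma difference_quotient_bound:
  assumes grad: "is_weak_gradient u g" and u: "u \<in> Lp_space 2" and g: "g \<in> Lp_space 2"
    and h: "0 < h"
  shows "integrable lborel (\<lambda>x. (norm (u (x + h *\<^sub>R axis i 1) - u x))\<^sup>2)"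
    and "(\<integral>x. (norm (u (x + h *\<^sub>R axis i 1) - u x))\<^sup>2 \<partial>lborel) \<le> h\<^sup>2 * (Lp_norm 2 g)\<^sup>2"
proof -
  let ?e = "axis i 1 :: R3"
  let ?g = "\<lambda>x. g x $ i"
  let ?D = "\<lambda>x. u (x + h *\<^sub>R ?e) - u x"
  have gi: "?g \<in> Lp_space 2" by (rule Lp_space_nth[OF g])
  have [measurable]: "u \<in> borel_measurable borel" "?g \<in> borel_measurable borel" "g \<in> borel_measurable borel"
    using u gi g by (simp_all add: Lp_space_2_iff)
  have D: "ennreal ((norm (?D x))\<^sup>2) \<le>
      ennreal h * (\<integral>\<^sup>+s. indicator {0..h} s * ennreal ((norm (g (x + s *\<^sub>R ?e)))\<^sup>2) \<partial>lborel)"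
    if "?D x = (\<integral>s. indicator {0..h} s *\<^sub>R ?g (x + s *\<^sub>R ?e) \<partial>lborel)" for x
  proof -
    \<comment> \<open>If the s-integral diverges, its value is 0 and the bound is trivial.\<close>
    have "ennreal (norm (?D x)) \<le> (\<integral>\<^sup>+s. norm (indicator {0..h} s *\<^sub>R ?g (x + s *\<^sub>R ?e)) \<partial>lborel)"
      unfolding that
      by (cases "integrable lborel (\<lambda>s. indicator {0..h} s *\<^sub>R ?g (x + s *\<^sub>R ?e))")
        (auto simp: not_integrable_integral_eq intro: integral_norm_bound_ennreal simp del: norm_scaleR)
    \<comment> \<open>The indicator is doubled so that Cauchy-Schwarz can pair one copy with the
      cut-off gradient. The component of g is bounded by the full norm, so each of the three
      directions later contributes the whole gradient norm.\<close>
    also have "\<dots> \<le> (\<integral>\<^sup>+s. indicator {0..h} s * (indicator {0..h} s * ennreal (norm (g (x + s *\<^sub>R ?e)))) \<partial>lborel)"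
      by (intro nn_integral_mono) (auto simp: indicator_def Finite_Cartesian_Product.norm_nth_le)
    finally have "(ennreal (norm (?D x)))\<^sup>2 \<le>
        (\<integral>\<^sup>+s. indicator {0..h} s * (indicator {0..h} s * ennreal (norm (g (x + s *\<^sub>R ?e)))) \<partial>lborel)\<^sup>2"
      by (rule power_mono) simp
    also have "\<dots> \<le> (\<integral>\<^sup>+s. (indicator {0..h} s)\<^sup>2 \<partial>lborel) *
        (\<integral>\<^sup>+s. (indicator {0..h} s * ennreal (norm (g (x + s *\<^sub>R ?e))))\<^sup>2 \<partial>lborel)"
      by (rule Cauchy_Schwarz_nn_integral) measurable
    also have "(\<lambda>s. (indicator {0..h} s)\<^sup>2) = (indicator {0..h} :: real \<Rightarrow> ennreal)"
      by (auto simp: indicator_def)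
    also have "(\<lambda>s. (indicator {0..h} s * ennreal (norm (g (x + s *\<^sub>R ?e))))\<^sup>2) =
        (\<lambda>s. indicator {0..h} s * ennreal ((norm (g (x + s *\<^sub>R ?e)))\<^sup>2))"
      by (auto simp: indicator_def ennreal_power)
    finally show ?thesis using h by (simp add: ennreal_power)
  qed
  have "(\<integral>\<^sup>+x. ennreal ((norm (?D x))\<^sup>2) \<partial>lborel) \<le>
      (\<integral>\<^sup>+x. ennreal h * (\<integral>\<^sup>+s. indicator {0..h} s * ennreal ((norm (g (x + s *\<^sub>R ?e)))\<^sup>2) \<partial>lborel) \<partial>lborel)"
    using weak_gradient_difference[OF grad u g h, of i]
    by (intro nn_integral_mono_AE) (auto elim!: eventually_mono intro: D)
  also have "\<dots> = ennreal h * (\<integral>\<^sup>+s. (\<integral>\<^sup>+x. indicator {0..h} s * ennreal ((norm (g (x + s *\<^sub>R ?e)))\<^sup>2) \<partial>lborel) \<partial>lborel)"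
    by (subst nn_integral_cmult, measurable, subst lborel_pair.Fubini', measurable)
  also have "(\<lambda>s. \<integral>\<^sup>+x. indicator {0..h} s * ennreal ((norm (g (x + s *\<^sub>R ?e)))\<^sup>2) \<partial>lborel) =
      (\<lambda>s. ennreal ((Lp_norm 2 g)\<^sup>2) * indicator {0..h} s)"
  proof
    fix s :: real
    have "integrable lborel (\<lambda>x. (norm (g (x + s *\<^sub>R ?e)))\<^sup>2)"
      using g integrable_lborel_translate_iff[of "\<lambda>x. (norm (g x))\<^sup>2"] by (simp add: Lp_space_2_iff)
    then have "(\<integral>\<^sup>+x. ennreal ((norm (g (x + s *\<^sub>R ?e)))\<^sup>2) \<partial>lborel) = ennreal ((Lp_norm 2 g)\<^sup>2)"
      using integral_lborel_translate[of "\<lambda>x. (norm (g x))\<^sup>2" "s *\<^sub>R ?e"]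
      by (simp add: nn_integral_eq_integral Lp_norm_2_squared)
    then show "(\<integral>\<^sup>+x. indicator {0..h} s * ennreal ((norm (g (x + s *\<^sub>R ?e)))\<^sup>2) \<partial>lborel) =
        ennreal ((Lp_norm 2 g)\<^sup>2) * indicator {0..h} s"
      by (simp add: nn_integral_cmult mult.commute)
  qed
  also have "ennreal h * (\<integral>\<^sup>+s. ennreal ((Lp_norm 2 g)\<^sup>2) * indicator {0..h} s \<partial>lborel) =
      ennreal (h\<^sup>2 * (Lp_norm 2 g)\<^sup>2)"
  proof -
    have "ennreal h * (\<integral>\<^sup>+s. ennreal ((Lp_norm 2 g)\<^sup>2) * indicator {0..h} s \<partial>lborel) =
        ennreal h * (ennreal ((Lp_norm 2 g)\<^sup>2) * ennreal h)"
      using h by (subst nn_integral_cmult_indicator) simp_all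
    also have "\<dots> = ennreal (h * ((Lp_norm 2 g)\<^sup>2 * h))"
      using h by (simp add: ennreal_mult)
    also have "h * ((Lp_norm 2 g)\<^sup>2 * h) = h\<^sup>2 * (Lp_norm 2 g)\<^sup>2"
      by (simp add: power2_eq_square)
    finally show ?thesis .
  qed
  finally have *: "(\<integral>\<^sup>+x. ennreal ((norm (?D x))\<^sup>2) \<partial>lborel) \<le> ennreal (h\<^sup>2 * (Lp_norm 2 g)\<^sup>2)" .
  show int: "integrable lborel (\<lambda>x. (norm (?D x))\<^sup>2)"
    using * by (intro integrableI_bounded) (auto simp: less_top[symmetric] top_unique)
  show "(\<integral>x. (norm (?D x))\<^sup>2 \<partial>lborel) \<le> h\<^sup>2 * (Lp_norm 2 g)\<^sup>2"
    using * int by (simp add: nn_integral_eq_integral)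
qed

section \<open>Hardy's inequality\<close>

text \<open>The vector field \<open>x / (\<bar>x\<bar>\<^sup>2 + e\<^sup>2)\<close>, a bounded version of the field \<open>x / \<bar>x\<bar>\<^sup>2\<close> whose
  divergence \<open>1 / \<bar>x\<bar>\<^sup>2\<close> is the Hardy weight in dimension 3.\<close>

definition hardy_weight :: "real \<Rightarrow> R3 \<Rightarrow> real" where
  "hardy_weight e x = 1 / ((norm x)\<^sup>2 + e\<^sup>2)"

definition hardy_field :: "real \<Rightarrow> 3 \<Rightarrow> R3 \<Rightarrow> real" where
  "hardy_field e i x = x $ i * hardy_weight e x"

lemma hardy_weight_bounds:
  assumes "0 < e"
  shows "0 < hardy_weight e x" "hardy_weight e x \<le> 1 / e\<^sup>2"
proof -
  have "0 < e\<^sup>2" using assms by simp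
  then show "0 < hardy_weight e x" "hardy_weight e x \<le> 1 / e\<^sup>2"
    unfolding hardy_weight_def by (auto intro!: divide_left_mono add_nonneg_pos mult_pos_pos)
qed

lemma borel_measurable_hardy [measurable]:
  "hardy_weight e \<in> borel_measurable borel" "hardy_field e i \<in> borel_measurable borel"
proof -
  show [measurable]: "hardy_weight e \<in> borel_measurable borel"
    unfolding hardy_weight_def by measurable
  have [measurable]: "(\<lambda>x::R3. x $ i) \<in> borel_measurable borel"
    by (intro borel_measurable_continuous_onI continuous_intros)
  show "hardy_field e i \<in> borel_measurable borel"
    unfolding hardy_field_def by measurable
qed

text \<open>This makes the absorption in Hardy's inequality possible: the squared components
  together cost at most one copy of the weight.\<close>

lemma sum_hardy_field_squared_le: "(\<Sum>i\<in>UNIV. (hardy_field e i x)\<^sup>2) \<le> hardy_weight e x"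
proof -
  have "(\<Sum>i\<in>UNIV. (hardy_field e i x)\<^sup>2) = (norm x)\<^sup>2 * (hardy_weight e x)\<^sup>2"
    by (simp add: hardy_field_def power_mult_distrib sum_distrib_right[symmetric] norm_vec_def
        L2_set_def sum_nonneg)
  also have "\<dots> \<le> ((norm x)\<^sup>2 + e\<^sup>2) * (hardy_weight e x)\<^sup>2"
    by (intro mult_right_mono) simp_all
  also have "\<dots> = hardy_weight e x"
    by (auto simp: hardy_weight_def power2_eq_square)
  finally show ?thesis .
qed

lemma hardy_field_squared_le:
  assumes "0 < e"
  shows "(hardy_field e i x)\<^sup>2 \<le> 1 / e\<^sup>2"
proof -
  have "(hardy_field e i x)\<^sup>2 \<le> (\<Sum>i\<in>UNIV. (hardy_field e i x)\<^sup>2)"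
    by (rule member_le_sum) simp_all
  also have "\<dots> \<le> 1 / e\<^sup>2"
    using sum_hardy_field_squared_le[of e x] hardy_weight_bounds(2)[OF assms, of x] by linarith
  finally show ?thesis .
qed

text \<open>With the coordinates other than \<open>i\<close> frozen the field is \<open>t / (t\<^sup>2 + r)\<close>.\<close>

lemma hardy_field_difference_quotient:
  fixes i :: 3
  assumes e: "0 < e" and h: "h \<noteq> 0"
  defines "r x \<equiv> 1 / hardy_weight e x - (x $ i)\<^sup>2"
  shows "(hardy_field e i x - hardy_field e i (x - h *\<^sub>R axis i 1)) / h =
      (r x - x $ i * (x $ i - h)) * hardy_weight e x * hardy_weight e (x - h *\<^sub>R axis i 1)"
    and "r (x - h *\<^sub>R axis i 1) = r x" and "e\<^sup>2 \<le> r x"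
proof -
  let ?y = "x - h *\<^sub>R axis i 1"
  have r: "r z = (\<Sum>j\<in>UNIV - {i}. (z $ j)\<^sup>2) + e\<^sup>2" for z
  proof -
    have "(norm z)\<^sup>2 = (\<Sum>j\<in>UNIV. (z $ j)\<^sup>2)"
      by (simp add: norm_vec_def L2_set_def sum_nonneg)
    also have "\<dots> = (z $ i)\<^sup>2 + (\<Sum>j\<in>UNIV - {i}. (z $ j)\<^sup>2)"
      by (rule sum.remove) simp_all
    finally show ?thesis by (simp add: r_def hardy_weight_def)
  qed
  show ry: "r ?y = r x"
    unfolding r by (intro arg_cong2[where f="(+)"] sum.cong refl) (simp add: axis_def)
  show "e\<^sup>2 \<le> r x"
    unfolding r by (simp add: sum_nonneg)
  then have pos: "0 < r x" using e by (smt (verit) zero_less_power)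
  have w: "hardy_weight e z = 1 / ((z $ i)\<^sup>2 + r z)" for z
    by (simp add: r_def)
  have yi: "?y $ i = x $ i - h" by simp
  define t where "t = x $ i"
  have "t\<^sup>2 + r x > 0" "(t - h)\<^sup>2 + r x > 0"
    using pos by (simp_all add: add_nonneg_pos)
  then have nz: "t\<^sup>2 + r x \<noteq> 0" "(t - h)\<^sup>2 + r x \<noteq> 0" by simp_all
  have "(t / (t\<^sup>2 + r x) - (t - h) / ((t - h)\<^sup>2 + r x)) =
      (t * ((t - h)\<^sup>2 + r x) - (t - h) * (t\<^sup>2 + r x)) / ((t\<^sup>2 + r x) * ((t - h)\<^sup>2 + r x))"
    using nz by (rule diff_frac_eq)
  also have "t * ((t - h)\<^sup>2 + r x) - (t - h) * (t\<^sup>2 + r x) = h * (r x - t * (t - h))"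
    by (simp add: power2_eq_square algebra_simps)
  finally show "(hardy_field e i x - hardy_field e i ?y) / h =
      (r x - x $ i * (x $ i - h)) * hardy_weight e x * hardy_weight e ?y"
    using h unfolding hardy_field_def w ry yi t_def[symmetric] by simp
qed

text \<open>The bound is uniform in x and h and so provides the dominating function for the limit h
  -> 0.\<close>

lemma hardy_field_lipschitz:
  assumes e: "0 < e" and h: "h \<noteq> 0"
  shows "\<bar>(hardy_field e i x - hardy_field e i (x - h *\<^sub>R axis i 1)) / h\<bar> \<le> 1 / e\<^sup>2"
proof -
  let ?y = "x - h *\<^sub>R axis i 1"
  define r where "r = 1 / hardy_weight e x - (x $ i)\<^sup>2"
  define t where "t = x $ i"
  note q = hardy_field_difference_quotient[OF e h, where i=i and x=x]
  have r: "e\<^sup>2 \<le> r" using q(3) by (simp add: r_def)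
  define p where "p = t\<^sup>2 + r"
  define q' where "q' = (t - h)\<^sup>2 + r"
  have wx: "hardy_weight e x = 1 / p"
    by (simp add: r_def p_def t_def)
  have wy: "hardy_weight e ?y = 1 / q'"
  proof -
    have "1 / hardy_weight e ?y = q'"
      using q(2) by (simp add: r_def q'_def t_def)
    then show ?thesis by auto
  qed
  have e2: "0 < e\<^sup>2" using e by simp
  then have pq: "e\<^sup>2 \<le> p" "e\<^sup>2 \<le> q'" "0 < p" "0 < q'"
    using r zero_le_power2[of t] zero_le_power2[of "t - h"] unfolding p_def q'_def by linarith+
  \<comment> \<open>Cauchy-Schwarz for the plane vectors (t, sqrt r) and (h - t, sqrt r): their
    squared lengths are p and q', their inner product is the left-hand base, and the remainder r (2
    t - h)^2 is the squared determinant from Lagrange's identity.\<close>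
  have "(r - t * (t - h))\<^sup>2 \<le> p * q'"
  proof -
    have "p * q' - (r - t * (t - h))\<^sup>2 = r * (2 * t - h)\<^sup>2"
      by (simp add: p_def q'_def power2_eq_square algebra_simps)
    moreover have "0 \<le> r" using r e2 by linarith
    then have "0 \<le> r * (2 * t - h)\<^sup>2" by simp
    ultimately show ?thesis by linarith
  qed
  then have sq: "\<bar>r - t * (t - h)\<bar> \<le> sqrt (p * q')"
    by (rule real_le_rsqrt[of "\<bar>r - t * (t - h)\<bar>", simplified])
  have "\<bar>(hardy_field e i x - hardy_field e i ?y) / h\<bar> = \<bar>r - t * (t - h)\<bar> / (p * q')"
    unfolding q(1) r_def[symmetric] unfolding t_def[symmetric] wx wy using pq by (simp add: abs_mult)
  also have "\<dots> \<le> sqrt (p * q') / (p * q')"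
    using sq pq by (intro divide_right_mono) simp_all
  also have "\<dots> = 1 / sqrt (p * q')"
    using pq by (simp add: real_div_sqrt field_simps)
  also have "\<dots> \<le> 1 / e\<^sup>2"
  proof -
    have "e\<^sup>2 * e\<^sup>2 \<le> p * q'"
      by (intro mult_mono) (use pq e2 in linarith)+
    then have "e\<^sup>2 \<le> sqrt (p * q')"
      by (intro real_le_rsqrt) (simp add: power2_eq_square)
    then show ?thesis using e2 by (intro divide_left_mono) (simp_all add: pq)
  qed
  finally show ?thesis .
qed

text \<open>The first limit is the i-th partial derivative of x_i / (|x|^2 + e^2), read off from the
  explicit quotient: (r - t^2) w^2 with r = 1/w - t^2, t = x_i and w the weight.\<close>

lemma hardy_field_difference_quotient_tendsto:
  assumes e: "0 < e" and h: "h \<longlonglongrightarrow> 0" "\<And>n. h n \<noteq> 0"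
  shows "(\<lambda>n. (hardy_field e i x - hardy_field e i (x - h n *\<^sub>R axis i 1)) / h n) \<longlonglongrightarrow>
      hardy_weight e x - 2 * (hardy_field e i x)\<^sup>2"
    and "(\<lambda>n. hardy_field e i (x - h n *\<^sub>R axis i 1)) \<longlonglongrightarrow> hardy_field e i x"
proof -
  have w0: "hardy_weight e x \<noteq> 0" using hardy_weight_bounds(1)[OF e, of x] by simp
  have "(norm x)\<^sup>2 + e\<^sup>2 \<noteq> 0"
    using e by (metis add_pos_nonneg add.commute less_irrefl zero_le_power2 zero_less_power)
  moreover have y: "(\<lambda>n. x - h n *\<^sub>R axis i 1) \<longlonglongrightarrow> x"
    using tendsto_diff[OF tendsto_const tendsto_scaleR[OF h(1) tendsto_const], of x "axis i 1"] by simp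
  ultimately have w: "(\<lambda>n. hardy_weight e (x - h n *\<^sub>R axis i 1)) \<longlonglongrightarrow> hardy_weight e x"
    unfolding hardy_weight_def by (intro tendsto_intros)
  then show "(\<lambda>n. hardy_field e i (x - h n *\<^sub>R axis i 1)) \<longlonglongrightarrow> hardy_field e i x"
    unfolding hardy_field_def by (intro tendsto_mult tendsto_vec_nth y)
  have "(\<lambda>n. (1 / hardy_weight e x - (x $ i)\<^sup>2 - x $ i * (x $ i - h n)) * hardy_weight e x *
      hardy_weight e (x - h n *\<^sub>R axis i 1)) \<longlonglongrightarrow>
      (1 / hardy_weight e x - (x $ i)\<^sup>2 - x $ i * (x $ i - 0)) * hardy_weight e x * hardy_weight e x"
    by (intro tendsto_intros w h)
  also have "(1 / hardy_weight e x - (x $ i)\<^sup>2 - x $ i * (x $ i - 0)) * hardy_weight e x * hardy_weight e x =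
      hardy_weight e x - 2 * (hardy_field e i x)\<^sup>2"
    using w0 by (simp add: hardy_field_def power2_eq_square algebra_simps)
  finally show "(\<lambda>n. (hardy_field e i x - hardy_field e i (x - h n *\<^sub>R axis i 1)) / h n) \<longlonglongrightarrow>
      hardy_weight e x - 2 * (hardy_field e i x)\<^sup>2"
    by (simp add: hardy_field_difference_quotient(1)[OF e h(2)])
qed

lemma integrable_bounded_mult:
  fixes f :: "'a \<Rightarrow> real"
  assumes "integrable M f" "\<psi> \<in> borel_measurable M" "\<And>x. \<bar>\<psi> x\<bar> \<le> C"
  shows "integrable M (\<lambda>x. \<psi> x * f x)"
proof (rule Bochner_Integration.integrable_bound)
  show "integrable M (\<lambda>x. C * f x)" using assms(1) by simp
  show "(\<lambda>x. \<psi> x * f x) \<in> borel_measurable M" using assms by measurable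
  have "\<bar>\<psi> x\<bar> * \<bar>f x\<bar> \<le> \<bar>C\<bar> * \<bar>f x\<bar>" for x
    using assms(3)[of x] by (intro mult_right_mono) auto
  then show "AE x in M. norm (\<psi> x * f x) \<le> norm (C * f x)"
    by (simp add: abs_mult)
qed

text \<open>Integration by parts against \<open>hardy_field\<close> at the level of difference quotients, with the
  product \<open>\<bar>\<phi>\<bar> \<bar>u\<bar> \<bar>\<partial>u\<bar>\<close> split by AM-GM so that the weighted part can be absorbed.\<close>

lemma hardy_difference_estimate:
  assumes grad: "is_weak_gradient u g" and u: "u \<in> Lp_space 2" and g: "g \<in> Lp_space 2"
    and e: "0 < e" and h: "0 < h"
  shows "(\<integral>x. (hardy_field e i x - hardy_field e i (x - h *\<^sub>R axis i 1)) / h * (norm (u x))\<^sup>2 \<partial>lborel)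
    \<le> 1 / 4 * (\<integral>x. (hardy_field e i x)\<^sup>2 * (norm (u x))\<^sup>2 \<partial>lborel)
      + 1 / 4 * (\<integral>x. (hardy_field e i (x - h *\<^sub>R axis i 1))\<^sup>2 * (norm (u x))\<^sup>2 \<partial>lborel)
      + 2 * (Lp_norm 2 g)\<^sup>2"
proof -
  let ?a = "h *\<^sub>R axis i 1 :: R3"
  let ?\<phi> = "hardy_field e i"
  let ?v = "\<lambda>x. u (x + ?a)"
  have [measurable]: "u \<in> borel_measurable borel" and u2: "integrable lborel (\<lambda>x. (norm (u x))\<^sup>2)"
    using u by (simp_all add: Lp_space_2_iff)
  have v2: "integrable lborel (\<lambda>x. (norm (?v x))\<^sup>2)"
    using integrable_lborel_translate_iff[of "\<lambda>x. (norm (u x))\<^sup>2"] u2 by simp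
  have sq: "\<bar>(?\<phi> x)\<^sup>2\<bar> \<le> 1 / e\<^sup>2" for x
    using hardy_field_squared_le[OF e, of i x] by simp
  have b: "\<bar>?\<phi> x\<bar> \<le> sqrt (1 / e\<^sup>2)" for x
    using real_sqrt_le_mono[OF hardy_field_squared_le[OF e, of i x]] by simp
  have i1: "integrable lborel (\<lambda>x. ?\<phi> x * (norm (u x))\<^sup>2)"
    and i2: "integrable lborel (\<lambda>x. ?\<phi> (x - ?a) * (norm (u x))\<^sup>2)"
    and i3: "integrable lborel (\<lambda>x. ?\<phi> x * (norm (?v x))\<^sup>2)"
    by ((rule integrable_bounded_mult[OF u2 _ b] integrable_bounded_mult[OF u2 _ b[of "_ - ?a"]]
        integrable_bounded_mult[OF v2 _ b]), measurable)+
  have s1: "integrable lborel (\<lambda>x. (?\<phi> x)\<^sup>2 * (norm (u x))\<^sup>2)"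
    and s2: "integrable lborel (\<lambda>x. (?\<phi> (x - ?a))\<^sup>2 * (norm (u x))\<^sup>2)"
    and s3: "integrable lborel (\<lambda>x. (?\<phi> x)\<^sup>2 * (norm (?v x))\<^sup>2)"
    by ((rule integrable_bounded_mult[OF u2 _ sq] integrable_bounded_mult[OF u2 _ sq[of "_ - ?a"]]
        integrable_bounded_mult[OF v2 _ sq]), measurable)+
  have D: "integrable lborel (\<lambda>x. (norm (?v x - u x))\<^sup>2)"
      "(\<integral>x. (norm (?v x - u x))\<^sup>2 \<partial>lborel) \<le> h\<^sup>2 * (Lp_norm 2 g)\<^sup>2"
    by (rule difference_quotient_bound[OF grad u g h])+
  have pw: "?\<phi> x * (norm (u x))\<^sup>2 - ?\<phi> x * (norm (?v x))\<^sup>2 \<le>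
      h / 4 * ((?\<phi> x)\<^sup>2 * (norm (u x))\<^sup>2) + h / 4 * ((?\<phi> x)\<^sup>2 * (norm (?v x))\<^sup>2)
        + 2 / h * (norm (?v x - u x))\<^sup>2" for x
  proof -
    define A B d f where "A = norm (u x)" "B = norm (?v x)" "d = norm (?v x - u x)" "f = ?\<phi> x"
    \<comment> \<open>The reverse triangle inequality controls the difference of the moduli by the
      difference quotient of u itself, so no derivative of |u| is taken.\<close>
    have "A \<le> B + d" "B \<le> A + d"
      using norm_triangle_ineq4[of "?v x" "?v x - u x"] norm_triangle_ineq[of "u x" "?v x - u x"]
      by (simp_all add: A_B_d_f_def)
    then have d: "\<bar>A - B\<bar> \<le> d" by linarith
    have nn: "0 \<le> A" "0 \<le> B" by (simp_all add: A_B_d_f_def)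
    \<comment> \<open>The weights are scaled by h for the later division by h: the weighted terms
      keep the factor 1/4, and d^2 / h is matched by the bound h^2 on the integral of d^2. Using it
      for A and for B gives the constant 2.\<close>
    have young: "\<bar>f\<bar> * c * d \<le> h / 4 * (f\<^sup>2 * c\<^sup>2) + 1 / h * d\<^sup>2" for c
    proof -
      have "0 \<le> (sqrt h / 2 * (\<bar>f\<bar> * c) - d / sqrt h)\<^sup>2" by simp
      also have "\<dots> = h / 4 * (f\<^sup>2 * c\<^sup>2) + 1 / h * d\<^sup>2 - \<bar>f\<bar> * c * d"
        using h by (simp add: power2_diff power_mult_distrib power_divide)
      finally show ?thesis by simp
    qed
    have "f * A\<^sup>2 - f * B\<^sup>2 = f * (A - B) * (A + B)"
      by (simp add: power2_eq_square algebra_simps)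
    also have "\<dots> \<le> \<bar>f\<bar> * d * (A + B)"
    proof (rule mult_right_mono)
      have "f * (A - B) \<le> \<bar>f\<bar> * \<bar>A - B\<bar>"
        using abs_ge_self[of "f * (A - B)"] by (simp add: abs_mult)
      also have "\<dots> \<le> \<bar>f\<bar> * d"
        using d by (rule mult_left_mono) simp
      finally show "f * (A - B) \<le> \<bar>f\<bar> * d" .
    qed (use nn in simp)
    also have "\<dots> = \<bar>f\<bar> * A * d + \<bar>f\<bar> * B * d"
      by (simp add: algebra_simps)
    also have "\<dots> \<le> h / 4 * (f\<^sup>2 * A\<^sup>2) + h / 4 * (f\<^sup>2 * B\<^sup>2) + 2 / h * d\<^sup>2"
      using young[of A] young[of B] by simp
    finally show ?thesis by (simp add: A_B_d_f_def)
  qed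
  have t1: "(\<integral>x. ?\<phi> x * (norm (?v x))\<^sup>2 \<partial>lborel) = (\<integral>x. ?\<phi> (x - ?a) * (norm (u x))\<^sup>2 \<partial>lborel)"
    using integral_lborel_translate[of "\<lambda>x. ?\<phi> (x - ?a) * (norm (u x))\<^sup>2" ?a] by simp
  have t2: "(\<integral>x. (?\<phi> x)\<^sup>2 * (norm (?v x))\<^sup>2 \<partial>lborel) = (\<integral>x. (?\<phi> (x - ?a))\<^sup>2 * (norm (u x))\<^sup>2 \<partial>lborel)"
    using integral_lborel_translate[of "\<lambda>x. (?\<phi> (x - ?a))\<^sup>2 * (norm (u x))\<^sup>2" ?a] by simp
  have "(\<integral>x. (?\<phi> x - ?\<phi> (x - ?a)) / h * (norm (u x))\<^sup>2 \<partial>lborel) =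
      (\<integral>x. 1 / h * (?\<phi> x * (norm (u x))\<^sup>2 - ?\<phi> (x - ?a) * (norm (u x))\<^sup>2) \<partial>lborel)"
    by (intro Bochner_Integration.integral_cong refl) (simp add: algebra_simps diff_divide_distrib)
  also have "\<dots> = 1 / h * ((\<integral>x. ?\<phi> x * (norm (u x))\<^sup>2 \<partial>lborel) - (\<integral>x. ?\<phi> x * (norm (?v x))\<^sup>2 \<partial>lborel))"
    unfolding t1 by (simp only: integral_mult_right_zero Bochner_Integration.integral_diff[OF i1 i2])
  also have "(\<integral>x. ?\<phi> x * (norm (u x))\<^sup>2 \<partial>lborel) - (\<integral>x. ?\<phi> x * (norm (?v x))\<^sup>2 \<partial>lborel) =
      (\<integral>x. ?\<phi> x * (norm (u x))\<^sup>2 - ?\<phi> x * (norm (?v x))\<^sup>2 \<partial>lborel)"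
    by (rule Bochner_Integration.integral_diff[OF i1 i3, symmetric])
  also have "1 / h * \<dots> \<le> 1 / h * (\<integral>x. h / 4 * ((?\<phi> x)\<^sup>2 * (norm (u x))\<^sup>2)
      + h / 4 * ((?\<phi> x)\<^sup>2 * (norm (?v x))\<^sup>2) + 2 / h * (norm (?v x - u x))\<^sup>2 \<partial>lborel)"
    using h pw by (intro mult_left_mono integral_mono Bochner_Integration.integrable_add
        Bochner_Integration.integrable_diff integrable_mult_right i1 i3 s1 s3 D(1)) simp_all
  also have "\<dots> = 1 / h * (h / 4 * (\<integral>x. (?\<phi> x)\<^sup>2 * (norm (u x))\<^sup>2 \<partial>lborel)
      + h / 4 * (\<integral>x. (?\<phi> (x - ?a))\<^sup>2 * (norm (u x))\<^sup>2 \<partial>lborel)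
      + 2 / h * (\<integral>x. (norm (?v x - u x))\<^sup>2 \<partial>lborel))"
    unfolding t2[symmetric] using s1 s3 D(1) by simp
  also have "\<dots> \<le> 1 / h * (h / 4 * (\<integral>x. (?\<phi> x)\<^sup>2 * (norm (u x))\<^sup>2 \<partial>lborel)
      + h / 4 * (\<integral>x. (?\<phi> (x - ?a))\<^sup>2 * (norm (u x))\<^sup>2 \<partial>lborel)
      + 2 / h * (h\<^sup>2 * (Lp_norm 2 g)\<^sup>2))"
    using h D(2) by (intro mult_left_mono add_left_mono) simp_all
  also have "\<dots> = 1 / 4 * (\<integral>x. (?\<phi> x)\<^sup>2 * (norm (u x))\<^sup>2 \<partial>lborel)
      + 1 / 4 * (\<integral>x. (?\<phi> (x - ?a))\<^sup>2 * (norm (u x))\<^sup>2 \<partial>lborel) + 2 * (Lp_norm 2 g)\<^sup>2"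
    using h by (simp add: power2_eq_square distrib_left)
  finally show ?thesis .
qed

text \<open>As h -> 0 the shifted field converges to the field, so the two quarters merge into one
  half. Both limits are dominated by |u|^2 / e^2.\<close>

lemma hardy_component_estimate:
  assumes grad: "is_weak_gradient u g" and u: "u \<in> Lp_space 2" and g: "g \<in> Lp_space 2"
    and e: "0 < e"
  shows "(\<integral>x. (hardy_weight e x - 2 * (hardy_field e i x)\<^sup>2) * (norm (u x))\<^sup>2 \<partial>lborel)
    \<le> 1 / 2 * (\<integral>x. (hardy_field e i x)\<^sup>2 * (norm (u x))\<^sup>2 \<partial>lborel) + 2 * (Lp_norm 2 g)\<^sup>2"
proof -
  define h where "h n = inverse (real (Suc n))" for n
  have h: "0 < h n" "h \<longlonglongrightarrow> 0" for n
    unfolding h_def by (simp, rule LIMSEQ_inverse_real_of_nat)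
  then have h0: "h n \<noteq> 0" for n by (metis less_irrefl)
  let ?\<phi> = "hardy_field e i" and ?a = "\<lambda>n. h n *\<^sub>R axis i 1 :: R3"
  have [measurable]: "u \<in> borel_measurable borel" and u2: "integrable lborel (\<lambda>x. (norm (u x))\<^sup>2)"
    using u by (simp_all add: Lp_space_2_iff)
  have dom: "integrable lborel (\<lambda>x. 1 / e\<^sup>2 * (norm (u x))\<^sup>2)"
    using u2 by simp
  have "(\<lambda>n. \<integral>x. (?\<phi> x - ?\<phi> (x - ?a n)) / h n * (norm (u x))\<^sup>2 \<partial>lborel) \<longlonglongrightarrow>
      (\<integral>x. (hardy_weight e x - 2 * (?\<phi> x)\<^sup>2) * (norm (u x))\<^sup>2 \<partial>lborel)"
  proof (rule integral_dominated_convergence[OF _ _ dom])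
    show "AE x in lborel. (\<lambda>n. (?\<phi> x - ?\<phi> (x - ?a n)) / h n * (norm (u x))\<^sup>2) \<longlonglongrightarrow>
        (hardy_weight e x - 2 * (?\<phi> x)\<^sup>2) * (norm (u x))\<^sup>2"
      by (intro AE_I2 tendsto_mult tendsto_const hardy_field_difference_quotient_tendsto(1) e h h0)
    show "AE x in lborel. norm ((?\<phi> x - ?\<phi> (x - ?a n)) / h n * (norm (u x))\<^sup>2) \<le> 1 / e\<^sup>2 * (norm (u x))\<^sup>2" for n
      unfolding real_norm_def abs_mult[of _ "(norm _)\<^sup>2"] abs_power2
      by (intro AE_I2 mult_right_mono hardy_field_lipschitz e h0) simp
  qed measurable
  moreover have "(\<lambda>n. 1 / 4 * (\<integral>x. (?\<phi> x)\<^sup>2 * (norm (u x))\<^sup>2 \<partial>lborel)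
      + 1 / 4 * (\<integral>x. (?\<phi> (x - ?a n))\<^sup>2 * (norm (u x))\<^sup>2 \<partial>lborel) + 2 * (Lp_norm 2 g)\<^sup>2) \<longlonglongrightarrow>
      1 / 4 * (\<integral>x. (?\<phi> x)\<^sup>2 * (norm (u x))\<^sup>2 \<partial>lborel)
      + 1 / 4 * (\<integral>x. (?\<phi> x)\<^sup>2 * (norm (u x))\<^sup>2 \<partial>lborel) + 2 * (Lp_norm 2 g)\<^sup>2"
  proof (intro tendsto_add tendsto_mult tendsto_const integral_dominated_convergence[OF _ _ dom])
    show "AE x in lborel. (\<lambda>n. (?\<phi> (x - ?a n))\<^sup>2 * (norm (u x))\<^sup>2) \<longlonglongrightarrow> (?\<phi> x)\<^sup>2 * (norm (u x))\<^sup>2"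
      by (intro AE_I2 tendsto_mult tendsto_power tendsto_const hardy_field_difference_quotient_tendsto(2) e h h0)
    show "AE x in lborel. norm ((?\<phi> (x - ?a n))\<^sup>2 * (norm (u x))\<^sup>2) \<le> 1 / e\<^sup>2 * (norm (u x))\<^sup>2" for n
      unfolding real_norm_def abs_mult[of _ "(norm _)\<^sup>2"] abs_power2
      by (intro AE_I2 mult_right_mono hardy_field_squared_le e) simp
  qed measurable
  ultimately have "(\<integral>x. (hardy_weight e x - 2 * (?\<phi> x)\<^sup>2) * (norm (u x))\<^sup>2 \<partial>lborel) \<le>
      1 / 4 * (\<integral>x. (?\<phi> x)\<^sup>2 * (norm (u x))\<^sup>2 \<partial>lborel)
      + 1 / 4 * (\<integral>x. (?\<phi> x)\<^sup>2 * (norm (u x))\<^sup>2 \<partial>lborel) + 2 * (Lp_norm 2 g)\<^sup>2"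
    by (rule LIMSEQ_le) (intro exI allI impI hardy_difference_estimate grad u g e h)
  then show ?thesis by simp
qed

text \<open>Write A for the weighted integral, S for the sum of the three integrals with squared
  field components and G for the gradient norm. Adding the component estimates gives 3 A <= 5/2 S +
  6 G^2, and S <= A leaves A/2 <= 6 G^2, whence 12. Absorption works because the dimension 3 exceeds
  5/2, and because A is finite, the weight being at most 1 / e^2.\<close>

lemma hardy_regularized:
  assumes grad: "is_weak_gradient u g" and u: "u \<in> Lp_space 2" and g: "g \<in> Lp_space 2"
    and e: "0 < e"
  shows "integrable lborel (\<lambda>x. hardy_weight e x * (norm (u x))\<^sup>2)"
    and "(\<integral>x. hardy_weight e x * (norm (u x))\<^sup>2 \<partial>lborel) \<le> 12 * (Lp_norm 2 g)\<^sup>2"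
proof -
  let ?\<phi> = "hardy_field e"
  have [measurable]: "u \<in> borel_measurable borel" and u2: "integrable lborel (\<lambda>x. (norm (u x))\<^sup>2)"
    using u by (simp_all add: Lp_space_2_iff)
  have wb: "\<bar>hardy_weight e x\<bar> \<le> 1 / e\<^sup>2" for x
    using hardy_weight_bounds[OF e, of x] by simp
  have sq: "\<bar>(?\<phi> i x)\<^sup>2\<bar> \<le> 1 / e\<^sup>2" for i x
    using hardy_field_squared_le[OF e, of i x] by simp
  show w: "integrable lborel (\<lambda>x. hardy_weight e x * (norm (u x))\<^sup>2)"
    by (rule integrable_bounded_mult[OF u2 _ wb]) measurable
  have s: "integrable lborel (\<lambda>x. (?\<phi> i x)\<^sup>2 * (norm (u x))\<^sup>2)" for i
    by (rule integrable_bounded_mult[OF u2 _ sq]) measurable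
  let ?A = "\<integral>x. hardy_weight e x * (norm (u x))\<^sup>2 \<partial>lborel"
  let ?S = "\<lambda>i. \<integral>x. (?\<phi> i x)\<^sup>2 * (norm (u x))\<^sup>2 \<partial>lborel"
  have "?A - 2 * ?S i \<le> 1 / 2 * ?S i + 2 * (Lp_norm 2 g)\<^sup>2" for i
  proof -
    have "(\<integral>x. (hardy_weight e x - 2 * (?\<phi> i x)\<^sup>2) * (norm (u x))\<^sup>2 \<partial>lborel) =
        (\<integral>x. hardy_weight e x * (norm (u x))\<^sup>2 - 2 * ((?\<phi> i x)\<^sup>2 * (norm (u x))\<^sup>2) \<partial>lborel)"
      by (intro Bochner_Integration.integral_cong refl) (simp add: algebra_simps)
    also have "\<dots> = ?A - 2 * ?S i"
      using w s by simp
    finally show ?thesis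
      using hardy_component_estimate[OF grad u g e, of i] by simp
  qed
  then have "(\<Sum>i\<in>(UNIV :: 3 set). ?A) \<le> (\<Sum>i\<in>(UNIV :: 3 set). 5 / 2 * ?S i + 2 * (Lp_norm 2 g)\<^sup>2)"
    by (intro sum_mono) (simp add: algebra_simps)
  then have "3 * ?A \<le> 5 / 2 * (\<Sum>i\<in>UNIV. ?S i) + 6 * (Lp_norm 2 g)\<^sup>2"
    by (simp add: sum.distrib sum_distrib_left)
  moreover have "(\<Sum>i\<in>UNIV. ?S i) \<le> ?A"
  proof -
    have "(\<Sum>i\<in>UNIV. ?S i) = (\<integral>x. (\<Sum>i\<in>UNIV. (?\<phi> i x)\<^sup>2) * (norm (u x))\<^sup>2 \<partial>lborel)"
      using s by (simp add: sum_distrib_right)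
    also have "\<dots> \<le> ?A"
    proof (rule integral_mono)
      show "integrable lborel (\<lambda>x. (\<Sum>i\<in>UNIV. (?\<phi> i x)\<^sup>2) * (norm (u x))\<^sup>2)"
        using s by (simp add: sum_distrib_right)
    qed (use w in \<open>simp_all add: mult_right_mono sum_hardy_field_squared_le\<close>)
    finally show ?thesis .
  qed
  ultimately show "?A \<le> 12 * (Lp_norm 2 g)\<^sup>2" by linarith
qed

text \<open>The constant 12 does not depend on e, so Fatou's lemma along e = 1 / (n + 1) gives
  finiteness and the bound together.\<close>

theorem hardy_inequality:
  assumes grad: "is_weak_gradient u g" and u: "u \<in> Lp_space 2" and g: "g \<in> Lp_space 2"
  shows "integrable lborel (\<lambda>x. (norm (u x))\<^sup>2 / (norm x)\<^sup>2)"
    and "(\<integral>x. (norm (u x))\<^sup>2 / (norm x)\<^sup>2 \<partial>lborel) \<le> 12 * (Lp_norm 2 g)\<^sup>2"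
proof -
  define h where "h n = inverse (real (Suc n))" for n
  have h: "0 < h n" "h \<longlonglongrightarrow> 0" for n
    unfolding h_def by (simp, rule LIMSEQ_inverse_real_of_nat)
  have [measurable]: "u \<in> borel_measurable borel"
    using u by (simp add: Lp_space_2_iff)
  have "(\<integral>\<^sup>+x. ennreal ((norm (u x))\<^sup>2 / (norm x)\<^sup>2) \<partial>lborel) =
      (\<integral>\<^sup>+x. liminf (\<lambda>n. ennreal (hardy_weight (h n) x * (norm (u x))\<^sup>2)) \<partial>lborel)"
  proof (rule nn_integral_cong_AE)
    \<comment> \<open>The origin has to be left out: division by zero makes the left side 0 there,
      whereas the regularized weights blow up.\<close>
    show "AE x in lborel. ennreal ((norm (u x))\<^sup>2 / (norm x)\<^sup>2) =
        liminf (\<lambda>n. ennreal (hardy_weight (h n) x * (norm (u x))\<^sup>2))"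
      using AE_lborel_singleton[of 0]
    proof eventually_elim
      case (elim x)
      have "(\<lambda>n. ennreal (1 / ((norm x)\<^sup>2 + (h n)\<^sup>2) * (norm (u x))\<^sup>2)) \<longlonglongrightarrow>
          ennreal (1 / ((norm x)\<^sup>2 + 0\<^sup>2) * (norm (u x))\<^sup>2)"
        using elim by (intro tendsto_ennrealI tendsto_intros h) simp
      then have "(\<lambda>n. ennreal (hardy_weight (h n) x * (norm (u x))\<^sup>2)) \<longlonglongrightarrow>
          ennreal ((norm (u x))\<^sup>2 / (norm x)\<^sup>2)"
        by (simp add: hardy_weight_def)
      then show ?case by (simp add: lim_imp_Liminf)
    qed
  qed
  also have "\<dots> \<le> liminf (\<lambda>n. \<integral>\<^sup>+x. ennreal (hardy_weight (h n) x * (norm (u x))\<^sup>2) \<partial>lborel)"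
    by (rule nn_integral_liminf) measurable
  also have "\<dots> \<le> ennreal (12 * (Lp_norm 2 g)\<^sup>2)"
  proof -
    have "(\<integral>\<^sup>+x. ennreal (hardy_weight (h n) x * (norm (u x))\<^sup>2) \<partial>lborel) \<le> ennreal (12 * (Lp_norm 2 g)\<^sup>2)" for n
      using hardy_regularized[OF grad u g h(1)[of n]] hardy_weight_bounds(1)[OF h(1)[of n], THEN less_imp_le]
      by (subst nn_integral_eq_integral) (auto intro!: ennreal_leI)
    then have "liminf (\<lambda>n. \<integral>\<^sup>+x. ennreal (hardy_weight (h n) x * (norm (u x))\<^sup>2) \<partial>lborel) \<le>
        liminf (\<lambda>n. ennreal (12 * (Lp_norm 2 g)\<^sup>2))"
      by (intro Liminf_mono always_eventually allI)
    then show ?thesis by (simp add: Liminf_const)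
  qed
  finally have *: "(\<integral>\<^sup>+x. ennreal ((norm (u x))\<^sup>2 / (norm x)\<^sup>2) \<partial>lborel) \<le> ennreal (12 * (Lp_norm 2 g)\<^sup>2)" .
  show int: "integrable lborel (\<lambda>x. (norm (u x))\<^sup>2 / (norm x)\<^sup>2)"
  proof (rule integrableI_nonneg)
    show "(\<integral>\<^sup>+x. ennreal ((norm (u x))\<^sup>2 / (norm x)\<^sup>2) \<partial>lborel) < \<infinity>"
      using * by (auto simp: less_top[symmetric] top_unique)
  qed simp_all
  show "(\<integral>x. (norm (u x))\<^sup>2 / (norm x)\<^sup>2 \<partial>lborel) \<le> 12 * (Lp_norm 2 g)\<^sup>2"
    using * int by (simp add: nn_integral_eq_integral)
qed

section \<open>Translating along the axis of the trap\<close>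

lemma coulomb_weight_integrable:
  assumes grad: "is_weak_gradient u g" and u: "u \<in> Lp_space 2" and g: "g \<in> Lp_space 2"
  shows "integrable lborel (\<lambda>x. (norm (u x))\<^sup>2 / norm x)"
proof -
  have [measurable]: "u \<in> borel_measurable borel" and u2: "integrable lborel (\<lambda>x. (norm (u x))\<^sup>2)"
    using u by (simp_all add: Lp_space_2_iff)
  have "integrable lborel (\<lambda>x. (norm (u x))\<^sup>2 / (norm x)\<^sup>2 + (norm (u x))\<^sup>2)"
    by (intro Bochner_Integration.integrable_add hardy_inequality(1)[OF grad u g] u2)
  then show ?thesis
  proof (rule Bochner_Integration.integrable_bound)
    show "AE x in lborel. norm ((norm (u x))\<^sup>2 / norm x) \<le>
        norm ((norm (u x))\<^sup>2 / (norm x)\<^sup>2 + (norm (u x))\<^sup>2)"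
      using AE_lborel_singleton[of 0]
    proof eventually_elim
      case (elim x)
      then have n: "0 < norm x" by simp
      have "1 / norm x \<le> 1 / (norm x)\<^sup>2 + 1"
      proof -
        have "1 / norm x \<le> (1 / norm x)\<^sup>2 + 1"
          using sum_squares_bound[of "1 / norm x" 1] divide_pos_pos[OF zero_less_one n]
          unfolding power_one mult_1_right by linarith
        then show ?thesis by (simp add: power_divide)
      qed
      from mult_left_mono[OF this, of "(norm (u x))\<^sup>2"] show ?case
        by (simp add: distrib_left)
    qed
  qed measurable
qed

text \<open>The part of the kernel near the origin costs at most d times Hardy's constant for the
  translate, which equals that for u because the gradient norm is invariant. So d can be fixed
  before the shift; the remaining kernel is at most 1/d and its integral vanishes in the limit of
  large shifts.\<close>

lemma coulomb_integral_translate_small: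
  assumes grad: "is_weak_gradient u g" and u: "u \<in> Lp_space 2" and g: "g \<in> Lp_space 2"
    and a: "norm a = 1" and \<epsilon>: "0 < \<epsilon>"
  obtains t :: real where "(\<integral>x. (norm (u (x + t *\<^sub>R a)))\<^sup>2 / norm x \<partial>lborel) < \<epsilon>"
proof -
  have [measurable]: "u \<in> borel_measurable borel" and u2: "integrable lborel (\<lambda>x. (norm (u x))\<^sup>2)"
    using u by (simp_all add: Lp_space_2_iff)
  define C where "C = 12 * (Lp_norm 2 g)\<^sup>2"
  have C: "0 \<le> C" by (simp add: C_def)
  \<comment> \<open>Chosen so that the Hardy part stays below \<epsilon> / 2; the summand 1 keeps
    the denominator positive when the gradient norm is 0.\<close>
  define d where "d = \<epsilon> / (2 * (C + 1))"
  have d: "0 < d" "d * C < \<epsilon> / 2"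
    using C \<epsilon> by (simp_all add: d_def field_simps)
  \<comment> \<open>The shift is placed on the kernel, so that |u|^2 / d dominates for every
    n.\<close>
  have "(\<lambda>n. \<integral>y. (norm (u y))\<^sup>2 * (1 / max d (norm (y - real n *\<^sub>R a))) \<partial>lborel) \<longlonglongrightarrow>
      (\<integral>y. (0::real) \<partial>(lborel :: R3 measure))"
  proof (rule integral_dominated_convergence)
    show "integrable lborel (\<lambda>y. (norm (u y))\<^sup>2 * (1 / d))"
      using u2 by simp
    show "AE y in lborel. (\<lambda>n. (norm (u y))\<^sup>2 * (1 / max d (norm (y - real n *\<^sub>R a)))) \<longlonglongrightarrow> 0"
    proof (rule AE_I2)
      fix y :: R3
      have "filterlim (\<lambda>n. - norm y + real n) at_top sequentially"
        by (intro filterlim_tendsto_add_at_top[OF tendsto_const] filterlim_real_sequentially)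
      moreover have "- norm y + real n \<le> max d (norm (y - real n *\<^sub>R a))" for n
        using norm_triangle_ineq2[of "real n *\<^sub>R a" y] a by (simp add: norm_minus_commute le_max_iff_disj)
      ultimately have "filterlim (\<lambda>n. max d (norm (y - real n *\<^sub>R a))) at_top sequentially"
        by (rule filterlim_at_top_mono[OF _ always_eventually[OF allI]])
      then have "(\<lambda>n. 1 / max d (norm (y - real n *\<^sub>R a))) \<longlonglongrightarrow> 0"
        by (rule real_tendsto_divide_at_top[OF tendsto_const])
      from tendsto_mult_right_zero[OF this]
      show "(\<lambda>n. (norm (u y))\<^sup>2 * (1 / max d (norm (y - real n *\<^sub>R a)))) \<longlonglongrightarrow> 0" .
    qed
    show "AE y in lborel. norm ((norm (u y))\<^sup>2 * (1 / max d (norm (y - real n *\<^sub>R a)))) \<le> (norm (u y))\<^sup>2 * (1 / d)" for n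
    proof (rule AE_I2)
      fix y :: R3
      have "1 / max d (norm (y - real n *\<^sub>R a)) \<le> 1 / d"
        using d by (intro divide_left_mono) simp_all
      from mult_left_mono[OF this, of "(norm (u y))\<^sup>2"]
      show "norm ((norm (u y))\<^sup>2 * (1 / max d (norm (y - real n *\<^sub>R a)))) \<le> (norm (u y))\<^sup>2 * (1 / d)"
        using d by simp
    qed
  qed measurable
  then have "(\<lambda>n. \<integral>y. (norm (u y))\<^sup>2 * (1 / max d (norm (y - real n *\<^sub>R a))) \<partial>lborel) \<longlonglongrightarrow> 0"
    by simp
  then have "\<forall>\<^sub>F n in sequentially. (\<integral>y. (norm (u y))\<^sup>2 * (1 / max d (norm (y - real n *\<^sub>R a))) \<partial>lborel) < \<epsilon> / 2"
    by (rule order_tendstoD(2)) (use \<epsilon> in simp)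
  then obtain n where n: "(\<integral>y. (norm (u y))\<^sup>2 * (1 / max d (norm (y - real n *\<^sub>R a))) \<partial>lborel) < \<epsilon> / 2"
    unfolding eventually_sequentially by blast
  let ?a = "real n *\<^sub>R a"
  let ?v = "\<lambda>x. u (x + ?a)"
  have v: "?v \<in> Lp_space 2" "(\<lambda>x. g (x + ?a)) \<in> Lp_space 2"
    by (rule Lp_space_translate, fact)+
  then have v2: "integrable lborel (\<lambda>x. (norm (?v x))\<^sup>2)"
    by (simp add: Lp_space_2_iff)
  note gv = is_weak_gradient_translate[OF grad, of ?a]
  note hardy = hardy_inequality[OF gv v]
  have far: "integrable lborel (\<lambda>x. 1 / max d (norm x) * (norm (?v x))\<^sup>2)"
  proof (rule integrable_bounded_mult[OF v2])
    show "\<bar>1 / max d (norm x)\<bar> \<le> 1 / d" for x :: R3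
      using d by (auto intro!: divide_left_mono)
  qed measurable
  have "(\<integral>x. (norm (?v x))\<^sup>2 / norm x \<partial>lborel) \<le>
      (\<integral>x. d * ((norm (?v x))\<^sup>2 / (norm x)\<^sup>2) + 1 / max d (norm x) * (norm (?v x))\<^sup>2 \<partial>lborel)"
  proof (rule integral_mono_AE)
    show "integrable lborel (\<lambda>x. (norm (?v x))\<^sup>2 / norm x)"
      by (rule coulomb_weight_integrable[OF gv v])
    show "integrable lborel (\<lambda>x. d * ((norm (?v x))\<^sup>2 / (norm x)\<^sup>2) + 1 / max d (norm x) * (norm (?v x))\<^sup>2)"
      by (intro Bochner_Integration.integrable_add integrable_mult_right hardy(1) far)
    show "AE x in lborel. (norm (?v x))\<^sup>2 / norm x \<le>
        d * ((norm (?v x))\<^sup>2 / (norm x)\<^sup>2) + 1 / max d (norm x) * (norm (?v x))\<^sup>2"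
      using AE_lborel_singleton[of 0]
    proof eventually_elim
      case (elim x)
      then have nx: "0 < norm x" by simp
      have "1 / norm x \<le> d / (norm x)\<^sup>2 + 1 / max d (norm x)"
      proof (cases "norm x \<le> d")
        case True
        then have "1 / norm x \<le> d / (norm x)\<^sup>2"
          using nx by (simp add: power2_eq_square divide_simps)
        moreover have "0 \<le> 1 / max d (norm x)" using d by simp
        ultimately show ?thesis by linarith
      next
        case False
        moreover have "0 \<le> d / (norm x)\<^sup>2" using d by simp
        ultimately show ?thesis by (simp add: max_def)
      qed
      from mult_left_mono[OF this, of "(norm (?v x))\<^sup>2"] show ?case
        by (simp add: algebra_simps)
    qed
  qed
  also have "\<dots> = d * (\<integral>x. (norm (?v x))\<^sup>2 / (norm x)\<^sup>2 \<partial>lborel) +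
      (\<integral>x. 1 / max d (norm x) * (norm (?v x))\<^sup>2 \<partial>lborel)"
    using hardy(1) far by (simp only: Bochner_Integration.integral_add integrable_mult_right integral_mult_right_zero)
  also have "(\<integral>x. 1 / max d (norm x) * (norm (?v x))\<^sup>2 \<partial>lborel) =
      (\<integral>y. (norm (u y))\<^sup>2 * (1 / max d (norm (y - ?a))) \<partial>lborel)"
    using integral_lborel_translate[of "\<lambda>y. (norm (u y))\<^sup>2 * (1 / max d (norm (y - ?a)))" ?a]
    by (simp add: mult.commute)
  also have "d * (\<integral>x. (norm (?v x))\<^sup>2 / (norm x)\<^sup>2 \<partial>lborel) \<le> d * C"
    using hardy(2) d unfolding Lp_norm_translate C_def[symmetric] by (intro mult_left_mono) simp_all
  finally have "(\<integral>x. (norm (?v x))\<^sup>2 / norm x \<partial>lborel) < \<epsilon>"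
    using n d by simp
  then show thesis by (rule that)
qed

section \<open>The energy of translates and the absence of minimizers\<close>

lemma convolution_translate:
  "convolution f (\<lambda>y. w (y + a)) x = convolution f w (x + a)"
  using integral_lborel_translate[of "\<lambda>y. f (x + a - y) * w y" a]
  by (simp add: convolution_def)

lemma mass_sphere_translate:
  assumes u: "u \<in> mass_sphere c" and a: "a $ 1 = 0" "a $ 2 = 0"
  shows "(\<lambda>x. u (x + a)) \<in> mass_sphere c"
proof -
  obtain g where g: "is_weak_gradient u g" "g \<in> Lp_space 2" and uL: "u \<in> Lp_space 2"
    using u by (auto simp: mass_sphere_def X_space_def H1_def)
  have "(\<lambda>x. u (x + a)) \<in> H1"
    unfolding H1_def
    using is_weak_gradient_translate[OF g(1), of a] Lp_space_translate[OF g(2), of a]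
      Lp_space_translate[OF uL, of a] by blast
  moreover have "integrable lborel (\<lambda>x. ((x $ 1)\<^sup>2 + (x $ 2)\<^sup>2) * (norm (u (x + a)))\<^sup>2)"
    using u integrable_lborel_translate_iff[of "\<lambda>x. ((x $ 1)\<^sup>2 + (x $ 2)\<^sup>2) * (norm (u x))\<^sup>2" a] a
    by (simp add: mass_sphere_def X_space_def)
  ultimately show ?thesis
    using u by (simp add: mass_sphere_def X_space_def Lp_norm_translate)
qed

text \<open>Stated as a difference, so that the invariant terms cancel and only the Coulomb
  integrals remain. The quartic term is invariant because convolution commutes with
  translations.\<close>

lemma energy_translate:
  assumes grad: "is_weak_gradient u g" and a: "a $ 1 = 0" "a $ 2 = 0"
  shows "energy b lam1 lam2 lam3 p (\<lambda>x. u (x + a)) - energy b lam1 lam2 lam3 p u =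
    lam1 / 2 * ((\<integral>x. (norm (u (x + a)))\<^sup>2 / norm x \<partial>lborel) - (\<integral>x. (norm (u x))\<^sup>2 / norm x \<partial>lborel))"
proof -
  have "Lp_norm 2 (weak_gradient (\<lambda>x. u (x + a))) = Lp_norm 2 (weak_gradient u)"
    by (simp only: Lp_norm_weak_gradient[OF is_weak_gradient_translate[OF grad]]
        Lp_norm_weak_gradient[OF grad] Lp_norm_translate)
  moreover have "(\<integral>x. ((x $ 1)\<^sup>2 + (x $ 2)\<^sup>2) * (norm (u (x + a)))\<^sup>2 \<partial>lborel) =
      (\<integral>x. ((x $ 1)\<^sup>2 + (x $ 2)\<^sup>2) * (norm (u x))\<^sup>2 \<partial>lborel)"
    using integral_lborel_translate[of "\<lambda>x. ((x $ 1)\<^sup>2 + (x $ 2)\<^sup>2) * (norm (u x))\<^sup>2" a] a by simp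
  moreover have "(\<integral>x. convolution (\<lambda>y. 1 / norm y) (\<lambda>y. (norm (u (y + a)))\<^sup>2) x * (norm (u (x + a)))\<^sup>2 \<partial>lborel) =
      (\<integral>x. convolution (\<lambda>y. 1 / norm y) (\<lambda>y. (norm (u y))\<^sup>2) x * (norm (u x))\<^sup>2 \<partial>lborel)"
    using integral_lborel_translate[of
        "\<lambda>x. convolution (\<lambda>y. 1 / norm y) (\<lambda>y. (norm (u y))\<^sup>2) x * (norm (u x))\<^sup>2" a]
      convolution_translate[of "\<lambda>y. 1 / norm y" "\<lambda>y. (norm (u y))\<^sup>2" a] by simp
  ultimately show ?thesis
    unfolding energy_def Lp_norm_translate[of "p + 2" u a] by (simp add: algebra_simps)
qed

text \<open>A nonnegative integrable function with integral 0 vanishes almost everywhere, which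
  contradicts the positive mass. Integrability excludes the value 0 that a divergent integral would
  have.\<close>

lemma coulomb_integral_pos:
  assumes grad: "is_weak_gradient u g" and u: "u \<in> Lp_space 2" and g: "g \<in> Lp_space 2"
    and mass: "0 < (Lp_norm 2 u)\<^sup>2"
  shows "0 < (\<integral>x. (norm (u x))\<^sup>2 / norm x \<partial>lborel)"
proof (rule ccontr)
  assume "\<not> 0 < (\<integral>x. (norm (u x))\<^sup>2 / norm x \<partial>lborel)"
  moreover have "0 \<le> (\<integral>x. (norm (u x))\<^sup>2 / norm x \<partial>lborel)" by simp
  ultimately have "(\<integral>x. (norm (u x))\<^sup>2 / norm x \<partial>lborel) = 0" by linarith
  then have "AE x in lborel. (norm (u x))\<^sup>2 / norm x = 0"
    using integral_nonneg_eq_0_iff_AE[OF coulomb_weight_integrable[OF grad u g]] by simp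
  then have "AE x in lborel. (norm (u x))\<^sup>2 = 0"
    using AE_lborel_singleton[of 0] by eventually_elim simp
  then have "(Lp_norm 2 u)\<^sup>2 = 0"
    unfolding Lp_norm_2_squared by (rule integral_eq_zero_AE)
  with mass show False by simp
qed

lemma exists_lower_energy_translate:
  assumes u: "u \<in> mass_sphere c" and "0 < c" and "0 < lam1"
  obtains v where "v \<in> mass_sphere c" "energy b lam1 lam2 lam3 p v < energy b lam1 lam2 lam3 p u"
proof -
  obtain g where grad: "is_weak_gradient u g" and g: "g \<in> Lp_space 2" and uL: "u \<in> Lp_space 2"
    using u by (auto simp: mass_sphere_def X_space_def H1_def)
  have "0 < (Lp_norm 2 u)\<^sup>2"
    using u \<open>0 < c\<close> by (simp add: mass_sphere_def)
  note pos = coulomb_integral_pos[OF grad uL g this]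
  have "norm (axis 3 1 :: R3) = 1" by (rule norm_axis_1)
  \<comment> \<open>The role of \<epsilon> is played by the Coulomb integral of u itself, so the
    translate has a strictly smaller one.\<close>
  from coulomb_integral_translate_small[OF grad uL g this pos]
  obtain t where t: "(\<integral>x. (norm (u (x + t *\<^sub>R axis 3 1)))\<^sup>2 / norm x \<partial>lborel) <
      (\<integral>x. (norm (u x))\<^sup>2 / norm x \<partial>lborel)"
    by blast
  let ?a = "t *\<^sub>R axis 3 1 :: R3"
  have a: "?a $ 1 = 0" "?a $ 2 = 0" by (simp_all add: axis_def)
  have "energy b lam1 lam2 lam3 p (\<lambda>x. u (x + ?a)) - energy b lam1 lam2 lam3 p u < 0"
    unfolding energy_translate[OF grad a] using t \<open>0 < lam1\<close> by (intro mult_pos_neg) simp_all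
  then show thesis
    using that[OF mass_sphere_translate[OF u a]] by simp
qed

theorem theorem5p3:
  fixes b lam1 lam2 lam3 p c :: real and R :: "R3 \<Rightarrow> real"
  assumes "b \<noteq> 0" and "lam1 > 0" and "lam2 \<le> 0" and "lam3 > 0"
    and "(0 < p \<and> p < 4 / 3 \<and> 0 < c) \<or>
         (p = 4 / 3 \<and> is_ground_state R \<and> 0 < c \<and> c < lam3 powr (- 3 / 2) * (Lp_norm 2 R)\<^sup>2)"
  shows "minimizers b lam1 lam2 lam3 p c = {}"
proof (rule equals0I)
  fix u assume u: "u \<in> minimizers b lam1 lam2 lam3 p c"
  have "0 < c" using assms(5) by blast
  then obtain v where v: "v \<in> mass_sphere c"
    and less: "energy b lam1 lam2 lam3 p v < energy b lam1 lam2 lam3 p u"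
    using u assms(2) exists_lower_energy_translate unfolding minimizers_def by blast
  have "ereal (energy b lam1 lam2 lam3 p u) \<le> ereal (energy b lam1 lam2 lam3 p v)"
    using u v unfolding minimizers_def min_energy_def by (auto intro: INF_lower)
  with less show False by simp
qed

end
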